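(* Let $(B(t))_{t\in\mathbb{R}}$ be a centered complex-valued wide-sense stationary process with continuous covariance function, spectral measure $\mu$ on $\mathbb{R}$ and spectral representation $B(t)=\int_{\mathbb{R}}e^{itu}\,\mathcal{W}(du)$. Assume that $\mu(du)=f(u)\,du$ with $\int_{\mathbb{R}}\frac{|\ln f(u)|}{1+u^2}\,du<\infty$. Let $\ell$ be an energy function (for instance, a polynomial with complex coefficients). Let $f=|\gamma_f|^2$ on $\mathbb{R}$ with $\gamma_f$ an outer function for the lower half-plane (in the sense of the context), and let $|\ell(iu)|^2+1=|\lambda_\ell(u)|^2$, $u\in\mathbb{R}$, with $\lambda_\ell$ satisfying conditions (i) and (ii) of the context. Let $Q_{>0}$ be the orthogonal projection of $\gamma_f/\overline{\lambda_\ell}$ onto $L^2_{>0}$ in the Hilbert space $L^2(\mathbb{R},\Lambda)$. Then the optimal adaptive approximation is given by $X(t)=\int_{\mathbb{R}}\widehat g_*(u)e^{itu}\,\mathcal{W}(du)$, $t\in\mathbb{R}$, with $$\widehat g_*(u)=\frac{1}{|\lambda_\ell(u)|^2}-\frac{Q_{>0}(u)}{\lambda_\ell(u)\gamma_f(u)},$$ that is, $\widehat g_*\in\widehat G_{\le 0}$ and $\widehat g_*$ minimizes $$\int_{\mathbb{R}}\left[|\widehat g(u)-1|^2+|\widehat g(u)|^2|\ell(iu)|^2\right]\mu(du)$$ over $\widehat g\in\widehat G_{\le 0}$. The (additional adaptivity) error of the adaptive approximation is given by $$\mathrm{ERR}_{\mathrm A}^+=\|Q_{>0}\|_2^2 .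$$
   Context: Setting. $\Lambda$ denotes Lebesgue measure ($du$) on $\mathbb{R}$ and $\|\cdot\|_2$ is the norm of $L^2(\mathbb{R},\Lambda)$. For a subset $A$ of a Hilbert space $H$, $\overline{\mathrm{span}}\{A\,|\,H\}$ is the closed linear span of $A$ in $H$. A centered process $B$ with $\mathbb{E}|B(t)|^2<\infty$ is wide-sense stationary if $\mathrm{Cov}(B(t_1),B(t_2))=K_B(t_1-t_2)$ depends only on $t_1-t_2$; $K_B$ is assumed continuous. Its spectral measure is the finite measure $\mu$ on $\mathbb{R}$ with $K_B(t)=\int_{\mathbb{R}}e^{itu}\mu(du)$, and $\mathcal{W}$ is the complex centered random measure on $\mathbb{R}$ with uncorrelated values, $\mathbb{E}|\mathcal{W}(A)|^2=\mu(A)$, such that $B(t)=\int_{\mathbb{R}}e^{itu}\mathcal{W}(du)$. Energy. An energy function $\ell$ is a complex-valued measurable function on the imaginary axis, typically the restriction of a polynomial $\ell(z)=\sum_{m=0}^M\ell_m z^m$. In the polynomial case the instant energy of a process $X$ is $\mathcal{E}[X](t)=\left|\sum_{m=0}^M\ell_m X^{(m)}(t)\right|^2$ (mean-square derivatives), and for $X(t)=\int_{\mathbb{R}}\widehat g(u)e^{itu}\mathcal{W}(du)$ the quantity $\mathbb{E}|X(0)-B(0)|^2+\mathbb{E}\,\mathcal{E}[X](0)$ equals $\int_{\mathbb{R}}[|\widehat g(u)-1|^2+|\widehat g(u)|^2|\ell(iu)|^2]\mu(du)$. Adaptive problem. Let $\widehat G_{\le 0}:=\overline{\mathrm{span}}\{e^{i\tau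 u},\ \tau\le 0\,|\,L^2(\mathbb{R},\mu)\}$. The adaptive approximation problem is to minimize the last integral over $\widehat g\in\widehat G_{\le 0}$ (equivalently, $X(t)$ lies in the closed linear span of $\{B(\tau):\tau\le t\}$ in $L^2(\Omega,\mathbb{P})$ for every $t$). The additional adaptivity error is $$\mathrm{ERR}_{\mathrm A}^+:=\min_{\widehat g\in\widehat G_{\le 0}}\int_{\mathbb{R}}\left|\widehat g(u)-\frac{1}{|\ell(iu)|^2+1}\right|^2\left(|\ell(iu)|^2+1\right)\mu(du).$$ It is the difference between the minimum of $\int_{\mathbb{R}}[|\widehat g-1|^2+|\widehat g|^2|\ell(iu)|^2]\,d\mu$ over $\widehat g\in\widehat G_{\le 0}$ and its minimum over all $\widehat g\in L^2(\mathbb{R},\mu)$, the latter being $\int_{\mathbb{R}}\frac{|\ell(iu)|^2}{|\ell(iu)|^2+1}\mu(du)$. Spaces. $L^2_{\le 0}$ and $L^2_{>0}$ are the closed subspaces of $L^2(\mathbb{R},\Lambda)$ consisting of the ($L^2$-)Fourier transforms $u\mapsto\int h(\tau)e^{i\tau u}d\tau$ of functions $h\in L^2(\mathbb{R},\Lambda)$ supported by $\mathbb{R}_-=(-\infty,0]$ and by $\mathbb{R}_+=[0,\infty)$, respectively. Outer functions. A function $\gamma\in L^2(\mathbb{R},\Lambda)$ is called outer for the lower half-plane if and only if $\overline{\mathrm{span}}\{\gamma e^{i\tau u},\ \tau\le 0\,|\,L^2(\mathbb{R},\Lambda)\}=L^2_{\le 0}$. Conditions on $\lambda_\ell$. (i)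 $\frac{1}{\lambda_\ell(u)}=\int_0^\infty e^{-i\tau u}\nu_\ell(d\tau)$, $u\in\mathbb{R}$, for some finite complex measure $\nu_\ell$ on $[0,\infty)$. (ii) If $\widehat g\in\widehat G_{\le 0}$ and $\lambda_\ell\widehat g\in L^2(\mathbb{R},\mu)$, then $\lambda_\ell\widehat g\in\widehat G_{\le 0}$. *)

theory Defs
  imports "HOL-Probability.Probability"
begin

text \<open>
  Elements of an \<open>L\<^sup>2\<close> space are represented by functions, and every subspace defined
  below is a set of functions closed under almost everywhere equality. The squared norm takes
  values in \<^typ>\<open>ennreal\<close>, so that it is infinite (and not a default value) off \<open>L\<^sup>2\<close>.
\<close>

definition square_integrable :: "'a measure \<Rightarrow> ('a \<Rightarrow> complex) \<Rightarrow> bool" where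
  "square_integrable M f \<longleftrightarrow>
     f \<in> borel_measurable M \<and> integrable M (\<lambda>x. (cmod (f x))\<^sup>2)"

definition L2_normsq :: "'a measure \<Rightarrow> ('a \<Rightarrow> complex) \<Rightarrow> ennreal" where
  "L2_normsq M f = (\<integral>\<^sup>+x. ennreal ((cmod (f x))\<^sup>2) \<partial>M)"

definition L2_inner :: "'a measure \<Rightarrow> ('a \<Rightarrow> complex) \<Rightarrow> ('a \<Rightarrow> complex) \<Rightarrow> complex" where
  "L2_inner M f g = (\<integral>x. f x * cnj (g x) \<partial>M)"

text \<open>Closed complex linear span in \<open>L\<^sup>2(M)\<close> of a set \<open>A\<close> of square-integrable functions.\<close>

definition closed_span :: "'a measure \<Rightarrow> ('a \<Rightarrow> complex) set \<Rightarrow> ('a \<Rightarrow> complex) set" where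
  "closed_span M A = {f. square_integrable M f \<and>
     (\<forall>\<epsilon>>0. \<exists>F c. finite F \<and> F \<subseteq> A \<and> L2_normsq M (\<lambda>x. f x - (\<Sum>a\<in>F. c a * a x)) < \<epsilon>)}"

definition orthogonal_projection ::
    "'a measure \<Rightarrow> ('a \<Rightarrow> complex) set \<Rightarrow> ('a \<Rightarrow> complex) \<Rightarrow> ('a \<Rightarrow> complex) \<Rightarrow> bool" where
  "orthogonal_projection M S v q \<longleftrightarrow>
     q \<in> S \<and> (\<forall>s\<in>S. L2_inner M (\<lambda>x. v x - q x) s = 0)"

subsection \<open>Fourier transforms and outer functions\<close>

text \<open>The \<open>L\<^sup>2\<close> Fourier transform is the limit in the mean of the transforms of the truncations.\<close>

definition is_L2_fourier :: "(real \<Rightarrow> complex) \<Rightarrow> (real \<Rightarrow> complex) \<Rightarrow> bool" where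
  "is_L2_fourier h F \<longleftrightarrow> square_integrable lborel h \<and> square_integrable lborel F \<and>
     ((\<lambda>T. L2_normsq lborel (\<lambda>u. F u - (CLBINT \<tau>:{-T..T}. h \<tau> * iexp (\<tau> * u)))) \<longlongrightarrow> 0) at_top"

definition L2_fourier_supported :: "real set \<Rightarrow> (real \<Rightarrow> complex) set" where
  "L2_fourier_supported S = {F. \<exists>h. (AE \<tau> in lborel. \<tau> \<notin> S \<longrightarrow> h \<tau> = 0) \<and> is_L2_fourier h F}"

abbreviation L2_nonpos :: "(real \<Rightarrow> complex) set" where
  "L2_nonpos \<equiv> L2_fourier_supported {..0}"

abbreviation L2_pos :: "(real \<Rightarrow> complex) set" where
  "L2_pos \<equiv> L2_fourier_supported {0..}"

definition outer_lower_half_plane :: "(real \<Rightarrow> complex) \<Rightarrow> bool" where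
  "outer_lower_half_plane \<gamma> \<longleftrightarrow> square_integrable lborel \<gamma> \<and>
     closed_span lborel {\<lambda>u. \<gamma> u * iexp (\<tau> * u) | \<tau>. \<tau> \<le> 0} = L2_nonpos"

subsection \<open>Complex measures\<close>

text \<open>
  A countably additive complex-valued set function on the Borel sets is automatically finite.
  The integral is taken through a decomposition \<open>\<nu> = (p - p') + i (q - q')\<close> into finite
  positive measures; its value does not depend on the decomposition, and the Jordan
  decompositions of the real and imaginary parts of \<open>\<nu>\<close> provide one.
\<close>

definition complex_measure :: "(real set \<Rightarrow> complex) \<Rightarrow> bool" where
  "complex_measure \<nu> \<longleftrightarrow>
     (\<forall>A :: nat \<Rightarrow> real set. range A \<subseteq> sets borel \<longrightarrow> disjoint_family A \<longrightarrow>
        (\<lambda>n. \<nu> (A n)) sums \<nu> (\<Union>n. A n))"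

definition concentrated_on :: "(real set \<Rightarrow> complex) \<Rightarrow> real set \<Rightarrow> bool" where
  "concentrated_on \<nu> S \<longleftrightarrow> (\<forall>A\<in>sets borel. A \<inter> S = {} \<longrightarrow> \<nu> A = 0)"

definition has_complex_measure_integral ::
    "(real set \<Rightarrow> complex) \<Rightarrow> (real \<Rightarrow> complex) \<Rightarrow> complex \<Rightarrow> bool" where
  "has_complex_measure_integral \<nu> g I \<longleftrightarrow>
     (\<exists>p p' q q'.
        (\<forall>m\<in>{p, p', q, q'}. finite_borel_measure m \<and> integrable m g) \<and>
        (\<forall>A\<in>sets borel. \<nu> A = Complex (measure p A - measure p' A) (measure q A - measure q' A)) \<and>
        I = (integral\<^sup>L p g - integral\<^sup>L p' g) + \<i> * (integral\<^sup>L q g - integral\<^sup>L q' g))"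

subsection \<open>Stationary processes and their spectral representation\<close>

definition covariance :: "'w measure \<Rightarrow> ('w \<Rightarrow> complex) \<Rightarrow> ('w \<Rightarrow> complex) \<Rightarrow> complex" where
  "covariance P X Y =
     (\<integral>\<omega>. (X \<omega> - integral\<^sup>L P X) * cnj (Y \<omega> - integral\<^sup>L P Y) \<partial>P)"

definition centered_stationary ::
    "'w measure \<Rightarrow> (real \<Rightarrow> 'w \<Rightarrow> complex) \<Rightarrow> (real \<Rightarrow> complex) \<Rightarrow> bool" where
  "centered_stationary P B K \<longleftrightarrow>
     (\<forall>t. square_integrable P (B t) \<and> integral\<^sup>L P (B t) = 0) \<and>
     (\<forall>t\<^sub>1 t\<^sub>2. covariance P (B t\<^sub>1) (B t\<^sub>2) = K (t\<^sub>1 - t\<^sub>2)) \<and>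
     continuous_on UNIV K"

definition is_spectral_measure :: "(real \<Rightarrow> complex) \<Rightarrow> real measure \<Rightarrow> bool" where
  "is_spectral_measure K \<mu> \<longleftrightarrow>
     finite_borel_measure \<mu> \<and> (\<forall>t. K t = (CLINT u|\<mu>. iexp (t * u)))"

definition uncorrelated_random_measure ::
    "'w measure \<Rightarrow> real measure \<Rightarrow> (real set \<Rightarrow> 'w \<Rightarrow> complex) \<Rightarrow> bool" where
  "uncorrelated_random_measure P \<mu> W \<longleftrightarrow>
     (\<forall>A\<in>sets borel. square_integrable P (W A) \<and> integral\<^sup>L P (W A) = 0 \<and>
        L2_normsq P (W A) = emeasure \<mu> A) \<and>
     (\<forall>A\<in>sets borel. \<forall>A'\<in>sets borel. A \<inter> A' = {} \<longrightarrow> covariance P (W A) (W A') = 0) \<and>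
     (\<forall>A :: nat \<Rightarrow> real set. range A \<subseteq> sets borel \<longrightarrow> disjoint_family A \<longrightarrow>
        (\<lambda>n. L2_normsq P (\<lambda>\<omega>. W (\<Union>k. A k) \<omega> - (\<Sum>k<n. W (A k) \<omega>))) \<longlonglongrightarrow> 0)"

text \<open>
  \<open>X = \<integral> \<phi> dW\<close>: the isometric extension to \<open>L\<^sup>2(\<mu>)\<close> of the elementary integral
  \<open>\<Sum> c\<^sub>k 1\<^bsub>A\<^sub>k\<^esub> \<mapsto> \<Sum> c\<^sub>k W(A\<^sub>k)\<close> on simple functions. This determines \<open>X\<close> up to
  almost sure equality.
\<close>

definition has_random_measure_integral ::
    "'w measure \<Rightarrow> real measure \<Rightarrow> (real set \<Rightarrow> 'w \<Rightarrow> complex) \<Rightarrow>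
     (real \<Rightarrow> complex) \<Rightarrow> ('w \<Rightarrow> complex) \<Rightarrow> bool" where
  "has_random_measure_integral P \<mu> W \<phi> X \<longleftrightarrow>
     square_integrable \<mu> \<phi> \<and> square_integrable P X \<and>
     (\<forall>\<epsilon>>0. \<exists>(n::nat) (c :: nat \<Rightarrow> complex) (A :: nat \<Rightarrow> real set).
        (\<forall>k<n. A k \<in> sets borel) \<and>
        L2_normsq \<mu> (\<lambda>u. \<phi> u - (\<Sum>k<n. c k * indicator (A k) u)) < \<epsilon> \<and>
        L2_normsq P (\<lambda>\<omega>. X \<omega> - (\<Sum>k<n. c k * W (A k) \<omega>)) < \<epsilon>)"

subsection \<open>The adaptive approximation problem\<close>

definition energy_function :: "(complex \<Rightarrow> complex) \<Rightarrow> bool" where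
  "energy_function l \<longleftrightarrow> l \<in> borel_measurable (restrict_space borel {z. Re z = 0})"

definition G_nonpos :: "real measure \<Rightarrow> (real \<Rightarrow> complex) set" where
  "G_nonpos \<mu> = closed_span \<mu> {\<lambda>u. iexp (\<tau> * u) | \<tau>. \<tau> \<le> 0}"

definition energy_objective ::
    "real measure \<Rightarrow> (complex \<Rightarrow> complex) \<Rightarrow> (real \<Rightarrow> complex) \<Rightarrow> ennreal" where
  "energy_objective \<mu> l g =
     (\<integral>\<^sup>+u. ennreal ((cmod (g u - 1))\<^sup>2 + (cmod (g u))\<^sup>2 * (cmod (l (\<i> * of_real u)))\<^sup>2) \<partial>\<mu>)"

definition adaptivity_defect ::
    "real measure \<Rightarrow> (complex \<Rightarrow> complex) \<Rightarrow> (real \<Rightarrow> complex) \<Rightarrow> ennreal" where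
  "adaptivity_defect \<mu> l g =
     (\<integral>\<^sup>+u. ennreal ((cmod (g u - of_real (1 / ((cmod (l (\<i> * of_real u)))\<^sup>2 + 1))))\<^sup>2 *
              ((cmod (l (\<i> * of_real u)))\<^sup>2 + 1)) \<partial>\<mu>)"

definition ERR_adaptive_plus :: "real measure \<Rightarrow> (complex \<Rightarrow> complex) \<Rightarrow> ennreal" where
  "ERR_adaptive_plus \<mu> l = (INF g\<in>G_nonpos \<mu>. adaptivity_defect \<mu> l g)"

definition inverse_is_causal_transform :: "(real \<Rightarrow> complex) \<Rightarrow> bool" where
  "inverse_is_causal_transform lam \<longleftrightarrow>
     (\<exists>\<nu>. complex_measure \<nu> \<and> concentrated_on \<nu> {0..} \<and>
        (\<forall>u. has_complex_measure_integral \<nu> (\<lambda>\<tau>. iexp (- (\<tau> * u))) (1 / lam u)))"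

definition multiplier_preserves_G_nonpos :: "real measure \<Rightarrow> (real \<Rightarrow> complex) \<Rightarrow> bool" where
  "multiplier_preserves_G_nonpos \<mu> lam \<longleftrightarrow>
     (\<forall>g\<in>G_nonpos \<mu>. square_integrable \<mu> (\<lambda>u. lam u * g u) \<longrightarrow> (\<lambda>u. lam u * g u) \<in> G_nonpos \<mu>)"

text \<open>
  In HOL \<open>ln 0 = 0\<close>, whereas the integral of \<open>|ln f(u)| / (1 + u\<^sup>2)\<close> can only be finite if
  \<open>f > 0\<close> almost everywhere; hence the explicit first conjunct.
\<close>

definition log_integrable :: "(real \<Rightarrow> real) \<Rightarrow> bool" where
  "log_integrable f \<longleftrightarrow> (AE u in lborel. 0 < f u) \<and>
     integrable lborel (\<lambda>u. \<bar>ln (f u)\<bar> / (1 + u\<^sup>2))"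

end

theory Submission
  imports Defs
begin

text \<open>
  Since \<open>f = |\<gamma>|\<^sup>2\<close>, multiplication by \<open>\<gamma>\<close> is an isometry from \<open>L\<^sup>2(\<mu>)\<close> to \<open>L\<^sup>2(\<real>)\<close>, and
  because \<open>\<gamma>\<close> is outer it carries the admissible functions onto \<^term>\<open>L2_nonpos\<close>. Put
  \<open>v = \<gamma> / cnj lam\<close>. Then the defect of \<open>g\<close> is the squared distance between \<open>\<gamma> lam g\<close> and \<open>v\<close>,
  and if it is finite, \<open>lam g\<close> is again admissible, so that \<open>\<gamma> lam g\<close> is in \<^term>\<open>L2_nonpos\<close>. The
  problem is therefore to approximate \<open>v\<close> from \<^term>\<open>L2_nonpos\<close>, whose orthogonal complement is
  \<^term>\<open>L2_pos\<close>. Write \<open>v = R + Q\<close> accordingly. By Pythagoras the defect of \<open>g\<close> is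
  \<open>\<parallel>\<gamma> lam g - R\<parallel>\<^sup>2 + \<parallel>Q\<parallel>\<^sup>2\<close>; it is smallest when \<open>\<gamma> lam g = R\<close>, which is the formula for the
  optimal \<open>g\<close>. This \<open>g\<close> is admissible: \<open>R / \<gamma>\<close> is, and as \<open>1 / lam\<close> is a causal transform, division by \<open>lam\<close> is a
  bounded pointwise limit of multiplications by exponential sums with nonpositive frequencies
  (\<open>causal_transform_approx\<close>, \<open>G_nonpos_mult_limit\<close>). The energy objective differs from the defect
  by a constant, as one sees by completing the square.

  The orthogonal decomposition needs Plancherel's theorem for the transform defined by limits in
  the mean. For indicators of intervals, Parseval's identity is Levy's inversion formula applied
  to a uniform distribution. A map that preserves inner products up to a factor extends from a
  family to its closed span (\<open>graph_closure_extension\<close>), here to all of \<open>L\<^sup>2\<close> because step functions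
  are dense. The adjoint of the transform arises in the same way from the conjugate kernel, so it
  is also a multiple of an isometry, and this makes the transform surjective.

  The same extension principle produces the approximating process. The exponentials in
  \<open>L\<^sup>2(\<mu>)\<close> have the inner products of the variables \<open>B(t)\<close> in \<open>L\<^sup>2(P)\<close>, so an approximation of
  \<open>g(u) e\<^bsup>itu\<^esup>\<close> by exponential sums with frequencies up to \<open>t\<close> becomes an approximation of \<open>X(t)\<close>
  by combinations of \<open>B(\<tau>)\<close> with \<open>\<tau> \<le> t\<close>.
\<close>


section \<open>Square-integrable functions\<close>

lemma borel_measurable_cnj [measurable (raw)]:
  "f \<in> borel_measurable M \<Longrightarrow> (\<lambda>x. cnj (f x)) \<in> borel_measurable M"
  by (rule borel_measurable_continuous_on[of cnj]) (auto intro: continuous_intros)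

lemma square_integrable_iff_normsq_finite:
  "square_integrable M f \<longleftrightarrow> f \<in> borel_measurable M \<and> L2_normsq M f < \<infinity>"
  unfolding square_integrable_def L2_normsq_def
  by (auto simp: integrable_iff_bounded)

lemma square_integrable_measurable:
  "square_integrable M f \<Longrightarrow> f \<in> borel_measurable M"
  by (simp add: square_integrable_def)

lemma L2_normsq_eq_integral:
  assumes "square_integrable M f"
  shows "L2_normsq M f = ennreal (\<integral>x. (cmod (f x))\<^sup>2 \<partial>M)"
  using assms unfolding L2_normsq_def square_integrable_def
  by (subst nn_integral_eq_integral) auto

lemma L2_normsq_cong_AE:
  "(AE x in M. f x = g x) \<Longrightarrow> L2_normsq M f = L2_normsq M g"
  unfolding L2_normsq_def by (intro nn_integral_cong_AE) auto

lemma cmod_sum_square_le: "(cmod (a + b))\<^sup>2 \<le> 2 * (cmod a)\<^sup>2 + 2 * (cmod b)\<^sup>2"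
proof -
  have "(cmod (a + b))\<^sup>2 \<le> (cmod a + cmod b)\<^sup>2"
    by (intro power_mono norm_triangle_ineq) auto
  also have "\<dots> \<le> 2 * (cmod a)\<^sup>2 + 2 * (cmod b)\<^sup>2"
    using sum_squares_bound[of "cmod a" "cmod b"] by (simp add: power2_sum)
  finally show ?thesis .
qed

text \<open>
  The factor 2 replaces the triangle inequality for the norm: it is enough for every
  convergence argument below and needs no square roots in \<^typ>\<open>ennreal\<close>.
\<close>

lemma L2_normsq_add_le:
  assumes "f \<in> borel_measurable M" "g \<in> borel_measurable M"
  shows "L2_normsq M (\<lambda>x. f x + g x) \<le> 2 * L2_normsq M f + 2 * L2_normsq M g"
proof -
  have [measurable]: "f \<in> borel_measurable M" "g \<in> borel_measurable M" by fact+
  have "L2_normsq M (\<lambda>x. f x + g x)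
      \<le> (\<integral>\<^sup>+x. 2 * ennreal ((cmod (f x))\<^sup>2) + 2 * ennreal ((cmod (g x))\<^sup>2) \<partial>M)"
    unfolding L2_normsq_def
  proof (rule nn_integral_mono)
    fix x
    have "ennreal ((cmod (f x + g x))\<^sup>2) \<le> ennreal (2 * (cmod (f x))\<^sup>2 + 2 * (cmod (g x))\<^sup>2)"
      by (intro ennreal_leI cmod_sum_square_le)
    also have "\<dots> = 2 * ennreal ((cmod (f x))\<^sup>2) + 2 * ennreal ((cmod (g x))\<^sup>2)"
      by (simp add: ennreal_plus ennreal_mult)
    finally show "ennreal ((cmod (f x + g x))\<^sup>2)
      \<le> 2 * ennreal ((cmod (f x))\<^sup>2) + 2 * ennreal ((cmod (g x))\<^sup>2)" .
  qed
  also have "\<dots> = 2 * L2_normsq M f + 2 * L2_normsq M g"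
    unfolding L2_normsq_def by (subst nn_integral_add) (auto simp: nn_integral_cmult)
  finally show ?thesis .
qed

lemma L2_normsq_diff_commute: "L2_normsq M (\<lambda>x. f x - g x) = L2_normsq M (\<lambda>x. g x - f x)"
  by (simp add: L2_normsq_def norm_minus_commute)

lemma L2_normsq_diff_le:
  assumes "f \<in> borel_measurable M" "g \<in> borel_measurable M" "h \<in> borel_measurable M"
  shows "L2_normsq M (\<lambda>x. f x - h x)
    \<le> 2 * L2_normsq M (\<lambda>x. f x - g x) + 2 * L2_normsq M (\<lambda>x. g x - h x)"
proof -
  have [measurable]: "f \<in> borel_measurable M" "g \<in> borel_measurable M" "h \<in> borel_measurable M"
    by fact+
  show ?thesis
    using L2_normsq_add_le[of "\<lambda>x. f x - g x" M "\<lambda>x. g x - h x"] by simp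
qed

lemma L2_normsq_cmult: "L2_normsq M (\<lambda>x. c * f x) = ennreal ((cmod c)\<^sup>2) * L2_normsq M f"
  if "f \<in> borel_measurable M"
  using that unfolding L2_normsq_def
  by (subst nn_integral_cmult[symmetric]) (auto simp: norm_mult power_mult_distrib ennreal_mult)

lemma square_integrable_add:
  assumes "square_integrable M f" "square_integrable M g"
  shows "square_integrable M (\<lambda>x. f x + g x)"
proof -
  have "L2_normsq M (\<lambda>x. f x + g x) \<le> 2 * L2_normsq M f + 2 * L2_normsq M g"
    using assms by (intro L2_normsq_add_le) (auto simp: square_integrable_def)
  also have "\<dots> < \<infinity>"
    using assms by (auto simp: square_integrable_iff_normsq_finite ennreal_mult_less_top)
  finally show ?thesis
    using assms by (auto simp: square_integrable_iff_normsq_finite)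
qed

lemma square_integrable_cmult:
  "square_integrable M f \<Longrightarrow> square_integrable M (\<lambda>x. c * f x)"
  by (auto simp: square_integrable_def norm_mult power_mult_distrib)

lemma square_integrable_diff:
  assumes "square_integrable M f" "square_integrable M g"
  shows "square_integrable M (\<lambda>x. f x - g x)"
  using square_integrable_add[OF assms(1) square_integrable_cmult[OF assms(2), of "-1"]] by simp

lemma square_integrable_sum:
  "(\<And>i. i \<in> F \<Longrightarrow> square_integrable M (f i)) \<Longrightarrow> square_integrable M (\<lambda>x. \<Sum>i\<in>F. f i x)"
  by (induction F rule: infinite_finite_induct)
     (auto simp: square_integrable_add, auto simp: square_integrable_def)

lemma square_integrable_lincomb:
  "(\<And>i. i \<in> F \<Longrightarrow> square_integrable M (a i)) \<Longrightarrow> square_integrable M (\<lambda>x. \<Sum>i\<in>F. c i * a i x)"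
  by (intro square_integrable_sum square_integrable_cmult)

lemma square_integrable_cong_AE:
  assumes "square_integrable M f" "g \<in> borel_measurable M" "AE x in M. f x = g x"
  shows "square_integrable M g"
  using assms L2_normsq_cong_AE[OF assms(3)] by (auto simp: square_integrable_iff_normsq_finite)

lemma square_integrable_bound:
  assumes "square_integrable M f" "g \<in> borel_measurable M" "\<And>x. cmod (g x) \<le> C * cmod (f x)"
  shows "square_integrable M g"
proof -
  have "integrable M (\<lambda>x. C\<^sup>2 * (cmod (f x))\<^sup>2)"
    using assms(1) by (auto simp: square_integrable_def)
  then have "integrable M (\<lambda>x. (cmod (g x))\<^sup>2)"
  proof (rule Bochner_Integration.integrable_bound)
    show "(\<lambda>x. (cmod (g x))\<^sup>2) \<in> borel_measurable M" using assms(2) by measurable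
    show "AE x in M. norm ((cmod (g x))\<^sup>2) \<le> norm (C\<^sup>2 * (cmod (f x))\<^sup>2)"
    proof (rule AE_I2)
      fix x
      have "(cmod (g x))\<^sup>2 \<le> (C * cmod (f x))\<^sup>2"
        by (intro power_mono assms) auto
      then show "norm ((cmod (g x))\<^sup>2) \<le> norm (C\<^sup>2 * (cmod (f x))\<^sup>2)"
        by (simp add: power_mult_distrib)
    qed
  qed
  then show ?thesis using assms(2) by (simp add: square_integrable_def)
qed

lemma square_integrable_cnj: "square_integrable M f \<Longrightarrow> square_integrable M (\<lambda>x. cnj (f x))"
  by (rule square_integrable_bound[of M f _ 1]) (auto simp: square_integrable_def)

lemma integrable_L2_inner:
  assumes "square_integrable M f" "square_integrable M g"
  shows "integrable M (\<lambda>x. f x * cnj (g x))"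
proof -
  have "integrable M (\<lambda>x. (cmod (f x))\<^sup>2 + (cmod (g x))\<^sup>2)"
    using assms by (auto simp: square_integrable_def)
  then show ?thesis
  proof (rule Bochner_Integration.integrable_bound)
    have "f \<in> borel_measurable M" "g \<in> borel_measurable M"
      using assms by (auto simp: square_integrable_def)
    then show "(\<lambda>x. f x * cnj (g x)) \<in> borel_measurable M" by measurable
    show "AE x in M. norm (f x * cnj (g x)) \<le> norm ((cmod (f x))\<^sup>2 + (cmod (g x))\<^sup>2)"
    proof (rule AE_I2)
      fix x
      have "2 * (cmod (f x) * cmod (g x)) \<le> (cmod (f x))\<^sup>2 + (cmod (g x))\<^sup>2"
        using sum_squares_bound[of "cmod (f x)" "cmod (g x)"] by simp
      moreover have "0 \<le> cmod (f x) * cmod (g x)" "0 \<le> (cmod (f x))\<^sup>2 + (cmod (g x))\<^sup>2" by auto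
      ultimately show "norm (f x * cnj (g x)) \<le> norm ((cmod (f x))\<^sup>2 + (cmod (g x))\<^sup>2)"
        unfolding norm_mult complex_mod_cnj real_norm_def by linarith
    qed
  qed
qed

lemma L2_inner_Cauchy_Schwarz:
  assumes "square_integrable M f" "square_integrable M g"
  shows "ennreal ((cmod (L2_inner M f g))\<^sup>2) \<le> L2_normsq M f * L2_normsq M g"
proof -
  have [measurable]: "f \<in> borel_measurable M" "g \<in> borel_measurable M"
    using assms by (auto simp: square_integrable_def)
  have "ennreal (cmod (L2_inner M f g)) \<le> (\<integral>\<^sup>+x. ennreal (cmod (f x)) * ennreal (cmod (g x)) \<partial>M)"
    unfolding L2_inner_def
    by (rule order_trans[OF integral_norm_bound_ennreal[OF integrable_L2_inner[OF assms]]])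
       (auto simp: norm_mult ennreal_mult)
  then have "(ennreal (cmod (L2_inner M f g)))\<^sup>2
      \<le> (\<integral>\<^sup>+x. ennreal (cmod (f x)) * ennreal (cmod (g x)) \<partial>M)\<^sup>2"
    by (rule power_mono) simp
  also have "\<dots> \<le> (\<integral>\<^sup>+x. (ennreal (cmod (f x)))\<^sup>2 \<partial>M) * (\<integral>\<^sup>+x. (ennreal (cmod (g x)))\<^sup>2 \<partial>M)"
    by (rule Cauchy_Schwarz_nn_integral) measurable
  finally show ?thesis
    by (simp add: L2_normsq_def ennreal_power)
qed

lemma L2_inner_diff_left:
  assumes "square_integrable M f" "square_integrable M g" "square_integrable M h"
  shows "L2_inner M (\<lambda>x. f x - g x) h = L2_inner M f h - L2_inner M g h"
  unfolding L2_inner_def using assms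
  by (simp add: ring_distribs integrable_L2_inner)

lemma L2_inner_diff_right:
  assumes "square_integrable M f" "square_integrable M g" "square_integrable M h"
  shows "L2_inner M h (\<lambda>x. f x - g x) = L2_inner M h f - L2_inner M h g"
  unfolding L2_inner_def using assms
  by (simp add: ring_distribs integrable_L2_inner)

lemma L2_inner_cmult_left: "L2_inner M (\<lambda>x. c * f x) g = c * L2_inner M f g"
  by (simp add: L2_inner_def mult.assoc)

lemma L2_inner_cmult_right: "L2_inner M f (\<lambda>x. c * g x) = cnj c * L2_inner M f g"
  by (simp add: L2_inner_def mult.left_commute)

lemma cnj_L2_inner: "cnj (L2_inner M f g) = L2_inner M g f"
  unfolding L2_inner_def by (subst Bochner_Integration.integral_cnj[symmetric]) (simp add: mult.commute)

lemma L2_inner_self: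
  "L2_inner M f f = of_real (\<integral>x. (cmod (f x))\<^sup>2 \<partial>M)"
proof -
  have "L2_inner M f f = (\<integral>x. complex_of_real ((cmod (f x))\<^sup>2) \<partial>M)"
    unfolding L2_inner_def by (simp only: complex_norm_square)
  then show ?thesis by (simp only: integral_complex_of_real)
qed

lemma L2_normsq_eq_inner:
  "square_integrable M f \<Longrightarrow> L2_normsq M f = ennreal (Re (L2_inner M f f))"
  by (simp add: L2_inner_self L2_normsq_eq_integral)

lemma L2_inner_lincomb_left:
  assumes "\<And>i. i \<in> F \<Longrightarrow> square_integrable M (a i)" "square_integrable M g"
  shows "L2_inner M (\<lambda>x. \<Sum>i\<in>F. c i * a i x) g = (\<Sum>i\<in>F. c i * L2_inner M (a i) g)"
proof -
  have "L2_inner M (\<lambda>x. \<Sum>i\<in>F. c i * a i x) g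
      = (\<integral>x. (\<Sum>i\<in>F. c i * (a i x * cnj (g x))) \<partial>M)"
    unfolding L2_inner_def by (simp add: sum_distrib_right mult.assoc)
  also have "\<dots> = (\<Sum>i\<in>F. (\<integral>x. c i * (a i x * cnj (g x)) \<partial>M))"
    using assms by (intro Bochner_Integration.integral_sum integrable_mult_right integrable_L2_inner) auto
  finally show ?thesis by (simp add: L2_inner_def)
qed

lemma L2_inner_lincomb_right:
  assumes "\<And>i. i \<in> F \<Longrightarrow> square_integrable M (a i)" "square_integrable M g"
  shows "L2_inner M g (\<lambda>x. \<Sum>i\<in>F. c i * a i x) = (\<Sum>i\<in>F. cnj (c i) * L2_inner M g (a i))"
proof -
  have "L2_inner M g (\<lambda>x. \<Sum>i\<in>F. c i * a i x) = cnj (L2_inner M (\<lambda>x. \<Sum>i\<in>F. c i * a i x) g)"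
    by (simp add: cnj_L2_inner)
  also have "\<dots> = (\<Sum>i\<in>F. cnj (c i) * L2_inner M g (a i))"
    by (subst L2_inner_lincomb_left[OF assms]) (auto simp: cnj_L2_inner)
  finally show ?thesis .
qed

lemma L2_normsq_eq_0_AE:
  assumes "f \<in> borel_measurable M" "g \<in> borel_measurable M" "L2_normsq M (\<lambda>x. f x - g x) = 0"
  shows "AE x in M. f x = g x"
proof -
  have "AE x in M. ennreal ((cmod (f x - g x))\<^sup>2) = 0"
    using assms unfolding L2_normsq_def by (subst nn_integral_0_iff_AE[symmetric]) auto
  then show ?thesis by (auto elim!: eventually_mono)
qed

lemma L2_inner_self_eq_0_AE:
  assumes "square_integrable M f" "L2_inner M f f = 0"
  shows "AE x in M. f x = 0"
  using L2_normsq_eq_0_AE[of f M "\<lambda>_. 0"] L2_normsq_eq_inner[OF assms(1)] assms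
  by (auto simp: square_integrable_def)

lemma L2_pythagoras:
  assumes "square_integrable M f" "square_integrable M g" "L2_inner M f g = 0"
  shows "L2_normsq M (\<lambda>x. f x - g x) = L2_normsq M f + L2_normsq M g"
proof -
  have "L2_inner M g f = 0" using assms(3) cnj_L2_inner[of M f g] by simp
  then have "L2_inner M (\<lambda>x. f x - g x) (\<lambda>x. f x - g x) = L2_inner M f f + L2_inner M g g"
    using assms by (simp add: L2_inner_diff_left L2_inner_diff_right square_integrable_diff)
  then show ?thesis
    using assms by (simp add: L2_normsq_eq_inner square_integrable_diff L2_inner_self ennreal_plus[symmetric]
      del: ennreal_plus)
qed

section \<open>Convergence in the mean\<close>

definition L2_tendsto :: "'a measure \<Rightarrow> (nat \<Rightarrow> 'a \<Rightarrow> complex) \<Rightarrow> ('a \<Rightarrow> complex) \<Rightarrow> bool" where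
  "L2_tendsto M s f \<longleftrightarrow> (\<forall>n. square_integrable M (s n)) \<and> square_integrable M f \<and>
     (\<lambda>n. L2_normsq M (\<lambda>x. f x - s n x)) \<longlonglongrightarrow> 0"

lemma tendsto_zero_cmodsq_ennreal:
  assumes "((\<lambda>n. ennreal ((cmod (z n))\<^sup>2)) \<longlongrightarrow> 0) F"
  shows "(z \<longlongrightarrow> 0) F"
proof -
  have "((\<lambda>n. ennreal ((cmod (z n))\<^sup>2)) \<longlongrightarrow> ennreal 0) F" using assms by simp
  then have "((\<lambda>n. (cmod (z n))\<^sup>2) \<longlongrightarrow> 0) F"
    by (rule tendsto_ennrealD) auto
  then have "((\<lambda>n. sqrt ((cmod (z n))\<^sup>2)) \<longlongrightarrow> sqrt 0) F" by (rule tendsto_real_sqrt)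
  then show ?thesis by (simp add: tendsto_norm_zero_iff)
qed

lemma L2_inner_tendsto:
  assumes "L2_tendsto M s f" "L2_tendsto M t g"
  shows "(\<lambda>n. L2_inner M (s n) (t n)) \<longlonglongrightarrow> L2_inner M f g"
proof -
  have si: "square_integrable M (s n)" "square_integrable M f"
    "square_integrable M (t n)" "square_integrable M g" for n
    using assms by (auto simp: L2_tendsto_def)
  let ?ds = "\<lambda>n x. f x - s n x" and ?dt = "\<lambda>n x. g x - t n x"
  have ds: "(\<lambda>n. L2_normsq M (?ds n)) \<longlonglongrightarrow> 0" and dt: "(\<lambda>n. L2_normsq M (?dt n)) \<longlonglongrightarrow> 0"
    using assms by (auto simp: L2_tendsto_def)
  have fin: "L2_normsq M f \<noteq> \<infinity>" "L2_normsq M g \<noteq> \<infinity>"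
    using si by (auto simp: square_integrable_iff_normsq_finite)
  have z: "(\<lambda>n. L2_inner M (p n) (q n)) \<longlonglongrightarrow> 0"
    if "\<And>n. square_integrable M (p n)" "\<And>n. square_integrable M (q n)"
      "(\<lambda>n. L2_normsq M (p n) * L2_normsq M (q n)) \<longlonglongrightarrow> 0" for p q
    by (rule tendsto_zero_cmodsq_ennreal,
        rule tendsto_sandwich[OF _ _ tendsto_const that(3)])
       (auto intro!: always_eventually L2_inner_Cauchy_Schwarz that)
  have 1: "(\<lambda>n. L2_inner M (?ds n) (?dt n)) \<longlonglongrightarrow> 0"
  proof (rule z)
    show "(\<lambda>n. L2_normsq M (?ds n) * L2_normsq M (?dt n)) \<longlonglongrightarrow> 0"
      using tendsto_mult_ennreal[OF ds dt] by simp
  qed (auto intro: square_integrable_diff si)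
  have 2: "(\<lambda>n. L2_inner M (?ds n) g) \<longlonglongrightarrow> 0"
  proof (rule z)
    show "(\<lambda>n. L2_normsq M (?ds n) * L2_normsq M g) \<longlonglongrightarrow> 0"
      using ennreal_tendsto_cmult[OF _ ds, of "L2_normsq M g"] fin
      by (simp add: mult.commute top.not_eq_extremum)
  qed (auto intro: square_integrable_diff si)
  have 3: "(\<lambda>n. L2_inner M f (?dt n)) \<longlonglongrightarrow> 0"
  proof (rule z)
    show "(\<lambda>n. L2_normsq M f * L2_normsq M (?dt n)) \<longlonglongrightarrow> 0"
      using ennreal_tendsto_cmult[OF _ dt, of "L2_normsq M f"] fin
      by (simp add: top.not_eq_extremum)
  qed (auto intro: square_integrable_diff si)
  have "L2_inner M (s n) (t n) = L2_inner M f g - L2_inner M (?ds n) g - L2_inner M f (?dt n)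
      + L2_inner M (?ds n) (?dt n)" for n
    using si by (simp add: L2_inner_diff_left L2_inner_diff_right square_integrable_diff)
  moreover have "(\<lambda>n. L2_inner M f g - L2_inner M (?ds n) g - L2_inner M f (?dt n)
      + L2_inner M (?ds n) (?dt n)) \<longlonglongrightarrow> L2_inner M f g - 0 - 0 + 0"
    by (intro tendsto_intros 1 2 3)
  ultimately show ?thesis by simp
qed

lemma L2_tendsto_cmult:
  assumes "L2_tendsto M s f"
  shows "L2_tendsto M (\<lambda>n x. z * s n x) (\<lambda>x. z * f x)"
proof -
  have "L2_normsq M (\<lambda>x. z * f x - z * s n x) = ennreal ((cmod z)\<^sup>2) * L2_normsq M (\<lambda>x. f x - s n x)" for n
    using assms unfolding right_diff_distrib[symmetric]
    by (intro L2_normsq_cmult borel_measurable_diff) (auto simp: L2_tendsto_def square_integrable_def)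
  moreover have "(\<lambda>n. ennreal ((cmod z)\<^sup>2) * L2_normsq M (\<lambda>x. f x - s n x)) \<longlonglongrightarrow> ennreal ((cmod z)\<^sup>2) * 0"
    using assms by (intro ennreal_tendsto_cmult) (auto simp: L2_tendsto_def)
  ultimately show ?thesis
    using assms by (simp add: L2_tendsto_def square_integrable_cmult)
qed

lemma L2_dominated_convergence:
  fixes w :: "'a \<Rightarrow> real"
  assumes "\<And>n. s n \<in> borel_measurable M" "f \<in> borel_measurable M"
    and "integrable M (\<lambda>x. (w x)\<^sup>2)"
    and lim: "AE x in M. (\<lambda>n. s n x) \<longlonglongrightarrow> f x"
    and bound: "\<And>n. AE x in M. cmod (s n x) \<le> w x"
  shows "L2_tendsto M s f"
proof -
  have [measurable]: "s n \<in> borel_measurable M" "f \<in> borel_measurable M" for n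
    by fact+
  have "AE x in M. \<forall>n. cmod (s n x) \<le> w x" using bound by (simp add: AE_all_countable)
  then have fb: "AE x in M. cmod (f x) \<le> w x"
    using lim
  proof eventually_elim
    case (elim x)
    show ?case
      by (rule LIMSEQ_le_const2[OF tendsto_norm[OF elim(2)]]) (use elim in auto)
  qed
  have sq: "square_integrable M g" if "g \<in> borel_measurable M" "AE x in M. cmod (g x) \<le> w x" for g
    unfolding square_integrable_def
  proof (intro conjI that Bochner_Integration.integrable_bound[OF assms(3)])
    show "AE x in M. norm ((cmod (g x))\<^sup>2) \<le> norm ((w x)\<^sup>2)"
      using that(2) by eventually_elim (auto intro: power_mono)
    show "(\<lambda>x. (cmod (g x))\<^sup>2) \<in> borel_measurable M" using that(1) by measurable
  qed
  have "(\<lambda>n. \<integral>\<^sup>+x. ennreal ((cmod (f x - s n x))\<^sup>2) \<partial>M) \<longlonglongrightarrow> (\<integral>\<^sup>+x. 0 \<partial>M)"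
  proof (rule nn_integral_dominated_convergence[where w="\<lambda>x. ennreal (4 * (w x)\<^sup>2)"])
    have w4: "integrable M (\<lambda>x. 4 * (w x)\<^sup>2)" using assms(3) by simp
    then show "(\<lambda>x. ennreal (4 * (w x)\<^sup>2)) \<in> borel_measurable M" by measurable
    show "(\<integral>\<^sup>+x. ennreal (4 * (w x)\<^sup>2) \<partial>M) < \<infinity>"
      using w4 by (simp add: nn_integral_eq_integral)
    show "AE x in M. (\<lambda>n. ennreal ((cmod (f x - s n x))\<^sup>2)) \<longlonglongrightarrow> 0"
      using lim
    proof eventually_elim
      case (elim x)
      have "(\<lambda>n. (cmod (f x - s n x))\<^sup>2) \<longlonglongrightarrow> (cmod (f x - f x))\<^sup>2"
        by (intro tendsto_intros elim)
      then show ?case by (subst ennreal_0[symmetric], intro tendsto_ennrealI) simp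
    qed
    show "AE x in M. ennreal ((cmod (f x - s n x))\<^sup>2) \<le> ennreal (4 * (w x)\<^sup>2)" for n
      using bound[of n] fb
    proof eventually_elim
      case (elim x)
      have "cmod (f x - s n x) \<le> 2 * w x"
        using norm_triangle_ineq4[of "f x" "s n x"] elim by linarith
      then have "(cmod (f x - s n x))\<^sup>2 \<le> (2 * w x)\<^sup>2" by (intro power_mono) auto
      then show ?case by (intro ennreal_leI) (simp add: power_mult_distrib)
    qed
  qed auto
  then show ?thesis
    unfolding L2_tendsto_def using sq[of f] sq[of "s n" for n] fb bound
    by (auto simp: L2_normsq_def)
qed

text \<open>
  Completeness, for a fast Cauchy sequence. The weights \<open>2\<^sup>n\<close> make the increments summable at
  almost every point, and Fatou's lemma turns pointwise convergence into convergence in the mean.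
\<close>

lemma L2_complete:
  assumes si: "\<And>n. square_integrable M (s n)"
    and cauchy: "\<And>m n. n \<le> m \<Longrightarrow> L2_normsq M (\<lambda>x. s m x - s n x) \<le> ennreal ((1/4)^n)"
  shows "\<exists>f. L2_tendsto M s f"
proof -
  have [measurable]: "s n \<in> borel_measurable M" for n
    using si by (simp add: square_integrable_def)
  define d where "d n x = cmod (s (Suc n) x - s n x)" for n x
  have [measurable]: "d n \<in> borel_measurable M" for n unfolding d_def by measurable
  have "(\<integral>\<^sup>+x. (\<Sum>n. ennreal (2^n * (d n x)\<^sup>2)) \<partial>M) = (\<Sum>n. \<integral>\<^sup>+x. ennreal (2^n * (d n x)\<^sup>2) \<partial>M)"
    by (intro nn_integral_suminf) measurable
  also have "\<dots> \<le> (\<Sum>n. ennreal ((1/2)^n))"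
  proof (intro suminf_le)
    fix n
    have "(\<integral>\<^sup>+x. ennreal (2^n * (d n x)\<^sup>2) \<partial>M) = ennreal (2^n) * L2_normsq M (\<lambda>x. s (Suc n) x - s n x)"
      unfolding L2_normsq_def d_def
      by (subst nn_integral_cmult[symmetric]) (auto simp: ennreal_mult)
    also have "\<dots> \<le> ennreal (2^n) * ennreal ((1/4)^n)"
      by (intro mult_left_mono cauchy) auto
    also have "\<dots> = ennreal ((1/2)^n)"
      by (simp add: ennreal_mult[symmetric] power_mult_distrib[symmetric])
    finally show "(\<integral>\<^sup>+x. ennreal (2^n * (d n x)\<^sup>2) \<partial>M) \<le> ennreal ((1/2)^n)" .
  qed auto
  also have "\<dots> < \<infinity>"
    using summable_geometric[of "1/2::real"] by (subst suminf_ennreal2) auto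
  finally have "(\<integral>\<^sup>+x. (\<Sum>n. ennreal (2^n * (d n x)\<^sup>2)) \<partial>M) \<noteq> \<infinity>" by simp
  then have "AE x in M. (\<Sum>n. ennreal (2^n * (d n x)\<^sup>2)) \<noteq> \<infinity>"
    by (intro nn_integral_noteq_infinite) auto
  then have conv: "AE x in M. Cauchy (\<lambda>n. s n x)"
  proof eventually_elim
    case (elim x)
    have "summable (\<lambda>n. 2^n * (d n x)\<^sup>2)"
      using elim by (intro summable_suminf_not_top) (auto simp: top_unique)
    then have "(\<lambda>n. 2^n * (d n x)\<^sup>2) \<longlonglongrightarrow> 0" by (rule summable_LIMSEQ_zero)
    then have "Bseq (\<lambda>n. 2^n * (d n x)\<^sup>2)" by (intro convergent_imp_Bseq convergentI)
    then obtain C where C: "C > 0" "\<And>n. norm (2^n * (d n x)\<^sup>2) \<le> C" by (auto elim: BseqE)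
    have "d n x \<le> sqrt C * (sqrt (1/2))^n" for n
    proof -
      have "(d n x)\<^sup>2 \<le> C * (1/2)^n"
        using C(2)[of n] by (simp add: abs_mult field_simps)
      then have "sqrt ((d n x)\<^sup>2) \<le> sqrt (C * (1/2)^n)" by (rule real_sqrt_le_mono)
      then show ?thesis by (simp add: d_def real_sqrt_mult real_sqrt_power real_sqrt_divide power_divide)
    qed
    then have le: "norm (s (Suc n) x - s n x) \<le> sqrt C * (sqrt (1/2))^n" for n
      by (simp add: d_def)
    have "summable (\<lambda>n. sqrt C * (sqrt (1/2))^n)"
      by (intro summable_mult summable_geometric) (auto simp: real_sqrt_divide)
    then have "summable (\<lambda>n. s (Suc n) x - s n x)"
      by (rule summable_comparison_test'[where N=0]) (rule le)
    then have "(\<lambda>n. \<Sum>k<n. s (Suc k) x - s k x) \<longlonglongrightarrow> (\<Sum>k. s (Suc k) x - s k x)"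
      by (rule summable_LIMSEQ)
    then have "(\<lambda>n. s n x - s 0 x) \<longlonglongrightarrow> (\<Sum>k. s (Suc k) x - s k x)"
      by (simp add: sum_lessThan_telescope[where f="\<lambda>n. s n x"])
    then have "(\<lambda>n. s n x - s 0 x + s 0 x) \<longlonglongrightarrow> (\<Sum>k. s (Suc k) x - s k x) + s 0 x"
      by (intro tendsto_intros)
    then show ?case by (intro LIMSEQ_imp_Cauchy) simp
  qed
  define f where "f x = lim (\<lambda>n. s n x)" for x
  have [measurable]: "f \<in> borel_measurable M" unfolding f_def by measurable
  have lim: "AE x in M. (\<lambda>n. s n x) \<longlonglongrightarrow> f x"
    using conv unfolding f_def by eventually_elim (simp add: Cauchy_convergent_iff convergent_LIMSEQ_iff)
  have close: "L2_normsq M (\<lambda>x. f x - s n x) \<le> ennreal ((1/4)^n)" for n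
  proof -
    have "L2_normsq M (\<lambda>x. f x - s n x)
        = (\<integral>\<^sup>+x. liminf (\<lambda>m. ennreal ((cmod (s m x - s n x))\<^sup>2)) \<partial>M)"
      unfolding L2_normsq_def
    proof (rule nn_integral_cong_AE)
      show "AE x in M. ennreal ((cmod (f x - s n x))\<^sup>2)
          = liminf (\<lambda>m. ennreal ((cmod (s m x - s n x))\<^sup>2))"
        using lim
      proof eventually_elim
        case (elim x)
        have "(\<lambda>m. ennreal ((cmod (s m x - s n x))\<^sup>2)) \<longlonglongrightarrow> ennreal ((cmod (f x - s n x))\<^sup>2)"
          by (intro tendsto_intros elim)
        then show ?case by (intro lim_imp_Liminf[symmetric]) auto
      qed
    qed
    also have "\<dots> \<le> liminf (\<lambda>m. \<integral>\<^sup>+x. ennreal ((cmod (s m x - s n x))\<^sup>2) \<partial>M)"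
      by (intro nn_integral_liminf) measurable
    also have "\<dots> \<le> limsup (\<lambda>m. \<integral>\<^sup>+x. ennreal ((cmod (s m x - s n x))\<^sup>2) \<partial>M)"
      by (intro Liminf_le_Limsup) auto
    also have "\<dots> \<le> ennreal ((1/4)^n)"
    proof (rule Limsup_bounded)
      show "\<forall>\<^sub>F m in sequentially. (\<integral>\<^sup>+x. ennreal ((cmod (s m x - s n x))\<^sup>2) \<partial>M) \<le> ennreal ((1/4)^n)"
        using eventually_ge_at_top[of n] by eventually_elim (rule cauchy[unfolded L2_normsq_def])
    qed
    finally show ?thesis .
  qed
  have "L2_normsq M (\<lambda>x. f x - s 0 x) < \<infinity>" using close[of 0] by (auto intro: le_less_trans)
  then have "square_integrable M (\<lambda>x. f x - s 0 x)"
    by (simp add: square_integrable_iff_normsq_finite)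
  then have "square_integrable M (\<lambda>x. (f x - s 0 x) + s 0 x)"
    by (rule square_integrable_add) (rule si)
  then have "square_integrable M f" by simp
  moreover have "(\<lambda>n. L2_normsq M (\<lambda>x. f x - s n x)) \<longlonglongrightarrow> 0"
  proof (rule tendsto_sandwich[OF _ _ tendsto_const])
    have "(\<lambda>n. (1/4::real)^n) \<longlonglongrightarrow> 0" by (rule LIMSEQ_realpow_zero) auto
    then have "(\<lambda>n. ennreal ((1/4)^n)) \<longlonglongrightarrow> ennreal 0" by (rule tendsto_ennrealI)
    then show "(\<lambda>n. ennreal ((1/4)^n)) \<longlonglongrightarrow> 0" by simp
  qed (auto intro: always_eventually close)
  ultimately show ?thesis unfolding L2_tendsto_def using si by blast
qed

section \<open>Closed spans and extension of isometries\<close>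

lemma ennreal_quarters_less:
  fixes \<epsilon> :: ennreal
  assumes "p < \<epsilon> / 4" "q < \<epsilon> / 4"
  shows "2 * p + 2 * q < \<epsilon>"
proof (cases \<epsilon>)
  case (real e)
  have e: "\<epsilon> / 4 = ennreal (e / 4)"
    using real by (metis divide_ennreal ennreal_numeral zero_le_numeral zero_less_numeral)
  obtain r where r: "p = ennreal r" "0 \<le> r" "r < e / 4"
    using assms(1) e by (cases p) (auto simp: ennreal_less_iff)
  obtain s where s: "q = ennreal s" "0 \<le> s" "s < e / 4"
    using assms(2) e by (cases q) (auto simp: ennreal_less_iff)
  have "2 * p + 2 * q = ennreal (2 * r + 2 * s)"
    using r s by (simp add: ennreal_plus ennreal_mult)
  also have "\<dots> < ennreal e"
    using r s by (subst ennreal_less_iff) auto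
  finally show ?thesis using real by simp
next
  case top
  then show ?thesis using assms by (auto simp: ennreal_top_divide ennreal_mult_less_top)
qed

lemma ennreal_quarter_pos: "0 < (\<epsilon>::ennreal) \<Longrightarrow> 0 < \<epsilon> / 4"
  by (simp add: ennreal_zero_less_divide)

locale L2_families =
  fixes M :: "'a measure" and N :: "'b measure"
    and a :: "'i \<Rightarrow> 'a \<Rightarrow> complex" and b :: "'i \<Rightarrow> 'b \<Rightarrow> complex" and I :: "'i set"
  assumes sq_a: "i \<in> I \<Longrightarrow> square_integrable M (a i)"
    and sq_b: "i \<in> I \<Longrightarrow> square_integrable N (b i)"
begin

text \<open>
  The pair \<open>(f, g)\<close> lies in the closure of the graph of the linear map \<open>a\<^sub>i \<mapsto> b\<^sub>i\<close>. Working
  with the graph gives an operator on \<open>L\<^sup>2\<close> without choosing representatives; with \<open>a = b\<close> it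
  describes the closed span itself.
\<close>

definition graph_closure :: "('a \<Rightarrow> complex) \<Rightarrow> ('b \<Rightarrow> complex) \<Rightarrow> bool" where
  "graph_closure f g \<longleftrightarrow> square_integrable M f \<and> square_integrable N g \<and>
     (\<forall>\<epsilon>>0. \<exists>J c. finite J \<and> J \<subseteq> I \<and>
        L2_normsq M (\<lambda>x. f x - (\<Sum>i\<in>J. c i * a i x)) < \<epsilon> \<and>
        L2_normsq N (\<lambda>y. g y - (\<Sum>i\<in>J. c i * b i y)) < \<epsilon>)"

lemma sq_comb:
  assumes "J \<subseteq> I"
  shows "square_integrable M (\<lambda>x. \<Sum>i\<in>J. c i * a i x)" "square_integrable N (\<lambda>x. \<Sum>i\<in>J. c i * b i x)"
  using assms sq_a sq_b by (auto intro!: square_integrable_lincomb)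

lemma graph_closure_sq:
  "graph_closure f g \<Longrightarrow> square_integrable M f" "graph_closure f g \<Longrightarrow> square_integrable N g"
  by (simp_all add: graph_closure_def)

lemma graph_closure_lincomb:
  assumes "finite J" "J \<subseteq> I"
  shows "graph_closure (\<lambda>x. \<Sum>i\<in>J. c i * a i x) (\<lambda>y. \<Sum>i\<in>J. c i * b i y)"
  unfolding graph_closure_def
  using assms sq_comb[OF assms(2)] by (auto intro!: exI[of _ J] exI[of _ c] simp: L2_normsq_def)

lemma graph_closure_base: "i \<in> I \<Longrightarrow> graph_closure (a i) (b i)"
  using graph_closure_lincomb[of "{i}" "\<lambda>_. 1"] by simp

text \<open>A pair within \<open>\<epsilon>/4\<close> of a pair of combinations within \<open>\<epsilon>/4\<close> is within \<open>\<epsilon>\<close> of it.\<close>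

lemma graph_closure_closed:
  assumes "square_integrable M f" "square_integrable N g"
    and "\<And>\<epsilon>::ennreal. 0 < \<epsilon> \<Longrightarrow> \<exists>f' g'. graph_closure f' g' \<and>
       L2_normsq M (\<lambda>x. f x - f' x) < \<epsilon> \<and> L2_normsq N (\<lambda>y. g y - g' y) < \<epsilon>"
  shows "graph_closure f g"
  unfolding graph_closure_def
proof (intro conjI assms allI impI)
  fix \<epsilon> :: ennreal assume "0 < \<epsilon>"
  then have e: "0 < \<epsilon> / 4" by (rule ennreal_quarter_pos)
  from assms(3)[OF this] obtain f' g' where 1: "graph_closure f' g'"
    "L2_normsq M (\<lambda>x. f x - f' x) < \<epsilon> / 4" "L2_normsq N (\<lambda>y. g y - g' y) < \<epsilon> / 4" by blast
  then obtain J c where 2: "finite J" "J \<subseteq> I"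
    "L2_normsq M (\<lambda>x. f' x - (\<Sum>i\<in>J. c i * a i x)) < \<epsilon> / 4"
    "L2_normsq N (\<lambda>y. g' y - (\<Sum>i\<in>J. c i * b i y)) < \<epsilon> / 4"
    using e unfolding graph_closure_def by meson
  note m = assms(1,2)[THEN square_integrable_measurable]
    graph_closure_sq[OF 1(1), THEN square_integrable_measurable]
    sq_comb[OF 2(2), THEN square_integrable_measurable]
  show "\<exists>J c. finite J \<and> J \<subseteq> I \<and>
        L2_normsq M (\<lambda>x. f x - (\<Sum>i\<in>J. c i * a i x)) < \<epsilon> \<and>
        L2_normsq N (\<lambda>y. g y - (\<Sum>i\<in>J. c i * b i y)) < \<epsilon>"
  proof (intro exI conjI)
    show "L2_normsq M (\<lambda>x. f x - (\<Sum>i\<in>J. c i * a i x)) < \<epsilon>"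
      by (rule le_less_trans[OF L2_normsq_diff_le[of f M f'] ennreal_quarters_less])
         (use m 1 2 in auto)
    show "L2_normsq N (\<lambda>y. g y - (\<Sum>i\<in>J. c i * b i y)) < \<epsilon>"
      by (rule le_less_trans[OF L2_normsq_diff_le[of g N g'] ennreal_quarters_less])
         (use m 1 2 in auto)
  qed (use 2 in auto)
qed

lemma graph_closure_tendsto:
  assumes "\<And>n. graph_closure (s n) (t n)" "L2_tendsto M s f" "L2_tendsto N t g"
  shows "graph_closure f g"
proof (rule graph_closure_closed)
  fix \<epsilon> :: ennreal assume "0 < \<epsilon>"
  then have "\<forall>\<^sub>F n in sequentially. L2_normsq M (\<lambda>x. f x - s n x) < \<epsilon>"
    "\<forall>\<^sub>F n in sequentially. L2_normsq N (\<lambda>x. g x - t n x) < \<epsilon>"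
    using assms(2,3) by (auto simp: L2_tendsto_def intro: order_tendstoD(2)[where y=0])
  then have "\<forall>\<^sub>F n in sequentially. L2_normsq M (\<lambda>x. f x - s n x) < \<epsilon> \<and> L2_normsq N (\<lambda>x. g x - t n x) < \<epsilon>"
    by eventually_elim auto
  then obtain n where "L2_normsq M (\<lambda>x. f x - s n x) < \<epsilon> \<and> L2_normsq N (\<lambda>x. g x - t n x) < \<epsilon>"
    using eventually_happens'[OF sequentially_bot] by fast
  then show "\<exists>f' g'. graph_closure f' g' \<and>
       L2_normsq M (\<lambda>x. f x - f' x) < \<epsilon> \<and> L2_normsq N (\<lambda>y. g y - g' y) < \<epsilon>"
    using assms(1) by blast
qed (use assms in \<open>auto simp: L2_tendsto_def\<close>)

lemma graph_closure_cong_AE: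
  assumes "graph_closure f g" "f' \<in> borel_measurable M" "g' \<in> borel_measurable N"
    "AE x in M. f x = f' x" "AE y in N. g y = g' y"
  shows "graph_closure f' g'"
proof (rule graph_closure_closed)
  fix \<epsilon> :: ennreal assume "0 < \<epsilon>"
  moreover have "L2_normsq M (\<lambda>x. f' x - f x) = L2_normsq M (\<lambda>x. 0)"
    "L2_normsq N (\<lambda>y. g' y - g y) = L2_normsq N (\<lambda>y. 0)"
    using assms(4,5) by (auto intro!: L2_normsq_cong_AE elim: eventually_mono)
  ultimately show "\<exists>f'' g''. graph_closure f'' g'' \<and>
       L2_normsq M (\<lambda>x. f' x - f'' x) < \<epsilon> \<and> L2_normsq N (\<lambda>y. g' y - g'' y) < \<epsilon>"
    using assms(1) by (intro exI[of _ f] exI[of _ g]) (auto simp: L2_normsq_def)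
qed (use assms in \<open>auto intro: square_integrable_cong_AE dest: graph_closure_sq\<close>)

lemma graph_closure_sequence:
  assumes "graph_closure f g"
  shows "\<exists>J c. (\<forall>n::nat. finite (J n) \<and> J n \<subseteq> I) \<and>
    L2_tendsto M (\<lambda>n x. \<Sum>i\<in>J n. c n i * a i x) f \<and> L2_tendsto N (\<lambda>n y. \<Sum>i\<in>J n. c n i * b i y) g"
proof -
  have "\<forall>n::nat. \<exists>J c. finite J \<and> J \<subseteq> I \<and>
        L2_normsq M (\<lambda>x. f x - (\<Sum>i\<in>J. c i * a i x)) < ennreal (1 / Suc n) \<and>
        L2_normsq N (\<lambda>y. g y - (\<Sum>i\<in>J. c i * b i y)) < ennreal (1 / Suc n)"
  proof
    fix n :: nat
    have "0 < ennreal (1 / Suc n)" by simp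
    then show "\<exists>J c. finite J \<and> J \<subseteq> I \<and>
        L2_normsq M (\<lambda>x. f x - (\<Sum>i\<in>J. c i * a i x)) < ennreal (1 / Suc n) \<and>
        L2_normsq N (\<lambda>y. g y - (\<Sum>i\<in>J. c i * b i y)) < ennreal (1 / Suc n)"
      using assms unfolding graph_closure_def by blast
  qed
  then obtain J c where J: "\<And>n::nat. finite (J n) \<and> J n \<subseteq> I \<and>
        L2_normsq M (\<lambda>x. f x - (\<Sum>i\<in>J n. c n i * a i x)) < ennreal (1 / Suc n) \<and>
        L2_normsq N (\<lambda>y. g y - (\<Sum>i\<in>J n. c n i * b i y)) < ennreal (1 / Suc n)"
    unfolding choice_iff by blast
  have "(\<lambda>n. ennreal (1 / Suc n)) \<longlonglongrightarrow> ennreal 0"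
    by (intro tendsto_ennrealI LIMSEQ_Suc lim_1_over_n)
  then have z: "(\<lambda>n. ennreal (1 / Suc n)) \<longlonglongrightarrow> 0" by simp
  have "(\<lambda>n. L2_normsq M (\<lambda>x. f x - (\<Sum>i\<in>J n. c n i * a i x))) \<longlonglongrightarrow> 0"
    "(\<lambda>n. L2_normsq N (\<lambda>y. g y - (\<Sum>i\<in>J n. c n i * b i y))) \<longlonglongrightarrow> 0"
    by (rule tendsto_sandwich[OF _ _ tendsto_const z]; use J in \<open>auto intro!: always_eventually less_imp_le\<close>)+
  then show ?thesis
    using J graph_closure_sq[OF assms] unfolding L2_tendsto_def
    by (intro exI[of _ J] exI[of _ c]) (simp add: sq_comb)
qed

lemma graph_closure_add:
  assumes "graph_closure f g" "graph_closure f' g'"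
  shows "graph_closure (\<lambda>x. f x + f' x) (\<lambda>y. g y + g' y)"
  unfolding graph_closure_def
proof (intro conjI allI impI square_integrable_add)
  note sq = graph_closure_sq[OF assms(1)] graph_closure_sq[OF assms(2)]
  fix \<epsilon> :: ennreal assume "0 < \<epsilon>"
  then have e: "0 < \<epsilon> / 4" by (rule ennreal_quarter_pos)
  obtain J c where 1: "finite J" "J \<subseteq> I"
    "L2_normsq M (\<lambda>x. f x - (\<Sum>i\<in>J. c i * a i x)) < \<epsilon> / 4"
    "L2_normsq N (\<lambda>y. g y - (\<Sum>i\<in>J. c i * b i y)) < \<epsilon> / 4"
    using e assms(1) unfolding graph_closure_def by meson
  obtain J' c' where 2: "finite J'" "J' \<subseteq> I"
    "L2_normsq M (\<lambda>x. f' x - (\<Sum>i\<in>J'. c' i * a i x)) < \<epsilon> / 4"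
    "L2_normsq N (\<lambda>y. g' y - (\<Sum>i\<in>J'. c' i * b i y)) < \<epsilon> / 4"
    using e assms(2) unfolding graph_closure_def by meson
  let ?c = "\<lambda>i. (if i \<in> J then c i else 0) + (if i \<in> J' then c' i else 0)"
  have eq: "(\<Sum>i\<in>J \<union> J'. ?c i * z i) = (\<Sum>i\<in>J. c i * z i) + (\<Sum>i\<in>J'. c' i * z i)" for z :: "'i \<Rightarrow> complex"
  proof -
    have "(\<Sum>i\<in>J \<union> J'. (if i \<in> J then c i else 0) * z i) = (\<Sum>i\<in>J. c i * z i)"
      by (rule sum.mono_neutral_cong_right) (use 1 2 in auto)
    moreover have "(\<Sum>i\<in>J \<union> J'. (if i \<in> J' then c' i else 0) * z i) = (\<Sum>i\<in>J'. c' i * z i)"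
      by (rule sum.mono_neutral_cong_right) (use 1 2 in auto)
    ultimately show ?thesis by (simp only: ring_distribs sum.distrib)
  qed
  note m = sq[THEN square_integrable_measurable]
    sq_comb[OF 1(2), THEN square_integrable_measurable] sq_comb[OF 2(2), THEN square_integrable_measurable]
  show "\<exists>J c. finite J \<and> J \<subseteq> I \<and>
        L2_normsq M (\<lambda>x. f x + f' x - (\<Sum>i\<in>J. c i * a i x)) < \<epsilon> \<and>
        L2_normsq N (\<lambda>y. g y + g' y - (\<Sum>i\<in>J. c i * b i y)) < \<epsilon>"
  proof (intro exI[of _ "J \<union> J'"] exI[of _ ?c] conjI)
    show "L2_normsq M (\<lambda>x. f x + f' x - (\<Sum>i\<in>J \<union> J'. ?c i * a i x)) < \<epsilon>"
      using le_less_trans[OF L2_normsq_add_le[of "\<lambda>x. f x - (\<Sum>i\<in>J. c i * a i x)" M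
        "\<lambda>x. f' x - (\<Sum>i\<in>J'. c' i * a i x)"] ennreal_quarters_less[OF 1(3) 2(3)]] m
      unfolding eq by (simp add: algebra_simps)
    show "L2_normsq N (\<lambda>y. g y + g' y - (\<Sum>i\<in>J \<union> J'. ?c i * b i y)) < \<epsilon>"
      using le_less_trans[OF L2_normsq_add_le[of "\<lambda>x. g x - (\<Sum>i\<in>J. c i * b i x)" N
        "\<lambda>x. g' x - (\<Sum>i\<in>J'. c' i * b i x)"] ennreal_quarters_less[OF 1(4) 2(4)]] m
      unfolding eq by (simp add: algebra_simps)
  qed (use 1 2 in auto)
qed (use assms in \<open>auto dest: graph_closure_sq\<close>)

lemma graph_closure_cmult:
  assumes "graph_closure f g"
  shows "graph_closure (\<lambda>x. z * f x) (\<lambda>y. z * g y)"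
proof -
  obtain J c where J: "\<And>n::nat. finite (J n)" "\<And>n. J n \<subseteq> I"
    and f: "L2_tendsto M (\<lambda>n x. \<Sum>i\<in>J n. c n i * a i x) f"
    and g: "L2_tendsto N (\<lambda>n y. \<Sum>i\<in>J n. c n i * b i y) g"
    using graph_closure_sequence[OF assms] by blast
  have "graph_closure (\<lambda>x. z * (\<Sum>i\<in>J n. c n i * a i x)) (\<lambda>y. z * (\<Sum>i\<in>J n. c n i * b i y))" for n
    using graph_closure_lincomb[OF J, where c="\<lambda>i. z * c n i"] by (simp add: sum_distrib_left mult.assoc)
  from graph_closure_tendsto[OF this L2_tendsto_cmult[OF f] L2_tendsto_cmult[OF g]] show ?thesis .
qed

lemma graph_closure_diff:
  assumes "graph_closure f g" "graph_closure f' g'"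
  shows "graph_closure (\<lambda>x. f x - f' x) (\<lambda>y. g y - g' y)"
  using graph_closure_add[OF assms(1) graph_closure_cmult[OF assms(2), of "-1"]] by simp

lemma graph_closure_sum:
  assumes "finite K" "\<And>k. k \<in> K \<Longrightarrow> graph_closure (f k) (g k)"
  shows "graph_closure (\<lambda>x. \<Sum>k\<in>K. c k * f k x) (\<lambda>y. \<Sum>k\<in>K. c k * g k y)"
  using assms
proof (induction K)
  case empty
  show ?case using graph_closure_lincomb[of "{}"] by simp
next
  case (insert k K)
  then show ?case
    unfolding sum.insert[OF insert(1,2)]
    by (intro graph_closure_add graph_closure_cmult) auto
qed

text \<open>A graph closure that contains the generators of another one contains all of it.\<close>

lemma graph_closure_trans:
  assumes "L2_families M N a' b' I'" "\<And>i. i \<in> I' \<Longrightarrow> graph_closure (a' i) (b' i)"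
    and "L2_families.graph_closure M N a' b' I' f g"
  shows "graph_closure f g"
proof -
  interpret A: L2_families M N a' b' I' by fact
  obtain J c where J: "\<And>n::nat. finite (J n)" "\<And>n. J n \<subseteq> I'"
    and f: "L2_tendsto M (\<lambda>n x. \<Sum>i\<in>J n. c n i * a' i x) f"
    and g: "L2_tendsto N (\<lambda>n y. \<Sum>i\<in>J n. c n i * b' i y) g"
    using A.graph_closure_sequence[OF assms(3)] by blast
  have "graph_closure (\<lambda>x. \<Sum>i\<in>J n. c n i * a' i x) (\<lambda>y. \<Sum>i\<in>J n. c n i * b' i y)" for n
    using J assms(2) by (intro graph_closure_sum) auto
  from graph_closure_tendsto[OF this f g] show ?thesis .
qed

end

lemma (in L2_families) swap_family: "L2_families N M b a I"
  by unfold_locales (rule sq_b sq_a, assumption)+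

lemma (in L2_families) graph_closure_swap:
  "L2_families.graph_closure N M b a I g f \<longleftrightarrow> graph_closure f g"
  unfolding graph_closure_def L2_families.graph_closure_def[OF swap_family] by blast

text \<open>Both sides are continuous in the pairs, and on finite combinations they agree by bilinearity.\<close>

lemma graph_closure_inner:
  assumes "L2_families M N a b I" "L2_families M N z y K"
    and "L2_families.graph_closure M N a b I f g"
    and "L2_families.graph_closure M N z y K k h"
    and gram: "\<And>i j. i \<in> I \<Longrightarrow> j \<in> K \<Longrightarrow> L2_inner N (b i) (y j) = \<kappa> * L2_inner M (a i) (z j)"
  shows "L2_inner N g h = \<kappa> * L2_inner M f k"
proof -
  interpret A: L2_families M N a b I by fact
  interpret B: L2_families M N z y K by fact
  obtain J c where J: "\<And>n::nat. finite (J n)" "\<And>n. J n \<subseteq> I"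
    and f: "L2_tendsto M (\<lambda>n x. \<Sum>i\<in>J n. c n i * a i x) f"
    and g: "L2_tendsto N (\<lambda>n y. \<Sum>i\<in>J n. c n i * b i y) g"
    using A.graph_closure_sequence[OF assms(3)] by blast
  obtain J' c' where J': "\<And>n::nat. finite (J' n)" "\<And>n. J' n \<subseteq> K"
    and k: "L2_tendsto M (\<lambda>n x. \<Sum>i\<in>J' n. c' n i * z i x) k"
    and h: "L2_tendsto N (\<lambda>n x. \<Sum>i\<in>J' n. c' n i * y i x) h"
    using B.graph_closure_sequence[OF assms(4)] by blast
  have bil: "L2_inner L (\<lambda>x. \<Sum>i\<in>J n. c n i * p i x) (\<lambda>x. \<Sum>j\<in>J' n. c' n j * q j x)
      = (\<Sum>i\<in>J n. c n i * (\<Sum>j\<in>J' n. cnj (c' n j) * L2_inner L (p i) (q j)))"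
    if "\<And>i. i \<in> I \<Longrightarrow> square_integrable L (p i)" "\<And>j. j \<in> K \<Longrightarrow> square_integrable L (q j)"
    for n and L :: "'x measure" and p q
    using J(2)[of n] J'(2)[of n] that
    by (subst L2_inner_lincomb_left)
       (auto intro!: sum.cong square_integrable_lincomb arg_cong2[where f="(*)"] L2_inner_lincomb_right)
  have "L2_inner N (\<lambda>x. \<Sum>i\<in>J n. c n i * b i x) (\<lambda>x. \<Sum>j\<in>J' n. c' n j * y j x)
      = \<kappa> * L2_inner M (\<lambda>x. \<Sum>i\<in>J n. c n i * a i x) (\<lambda>x. \<Sum>j\<in>J' n. c' n j * z j x)" for n
    using J(2)[of n] J'(2)[of n] gram A.sq_a A.sq_b B.sq_a B.sq_b
    by (subst (1 2) bil) (auto intro!: sum.cong simp: sum_distrib_left mult_ac subset_iff)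
  then have "(\<lambda>n. \<kappa> * L2_inner M (\<lambda>x. \<Sum>i\<in>J n. c n i * a i x) (\<lambda>x. \<Sum>j\<in>J' n. c' n j * z j x))
      \<longlonglongrightarrow> L2_inner N g h"
    using L2_inner_tendsto[OF g h] by (simp only:)
  then show ?thesis
    using tendsto_mult_left[OF L2_inner_tendsto[OF f k], of \<kappa>] by (rule LIMSEQ_unique)
qed

text \<open>
  If the Gram matrices of two families are proportional, then \<open>a\<^sub>i \<mapsto> b\<^sub>i\<close> is a multiple of an
  isometry on finite combinations, so it extends to the closed span by completeness.
\<close>

lemma L2_normsq_lincomb_gram:
  assumes "\<And>i. i \<in> J \<Longrightarrow> square_integrable M (a i)" "\<And>i. i \<in> J \<Longrightarrow> square_integrable N (b i)"
    and "\<And>i j. i \<in> J \<Longrightarrow> j \<in> J \<Longrightarrow> L2_inner N (b i) (b j) = of_real \<kappa> * L2_inner M (a i) (a j)"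
    and "0 \<le> \<kappa>"
  shows "L2_normsq N (\<lambda>x. \<Sum>i\<in>J. c i * b i x) = ennreal \<kappa> * L2_normsq M (\<lambda>x. \<Sum>i\<in>J. c i * a i x)"
proof -
  have bil: "L2_inner L (\<lambda>x. \<Sum>i\<in>J. c i * p i x) (\<lambda>x. \<Sum>j\<in>J. c j * p j x)
      = (\<Sum>i\<in>J. c i * (\<Sum>j\<in>J. cnj (c j) * L2_inner L (p i) (p j)))"
    if "\<And>i. i \<in> J \<Longrightarrow> square_integrable L (p i)" for L :: "'x measure" and p
    using that by (subst L2_inner_lincomb_left)
       (auto intro!: sum.cong square_integrable_lincomb arg_cong2[where f="(*)"] L2_inner_lincomb_right)
  have "L2_inner N (\<lambda>x. \<Sum>i\<in>J. c i * b i x) (\<lambda>x. \<Sum>i\<in>J. c i * b i x)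
      = of_real \<kappa> * L2_inner M (\<lambda>x. \<Sum>i\<in>J. c i * a i x) (\<lambda>x. \<Sum>i\<in>J. c i * a i x)"
    using assms by (subst (1 2) bil) (auto simp: sum_distrib_left mult_ac intro!: sum.cong)
  then show ?thesis
    using assms by (simp add: L2_normsq_eq_inner square_integrable_lincomb ennreal_mult'' mult.commute)
       (simp add: L2_inner_self ennreal_mult'')
qed

context L2_families
begin

lemma graph_closure_extension:
  assumes gram: "\<And>i j. i \<in> I \<Longrightarrow> j \<in> I \<Longrightarrow> L2_inner N (b i) (b j) = of_real \<kappa> * L2_inner M (a i) (a j)"
    and "0 \<le> \<kappa>" and "square_integrable M f"
    and approx: "\<And>\<epsilon>::ennreal. 0 < \<epsilon> \<Longrightarrow> \<exists>J c. finite J \<and> J \<subseteq> I \<and>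
        L2_normsq M (\<lambda>x. f x - (\<Sum>i\<in>J. c i * a i x)) < \<epsilon>"
  shows "\<exists>g. graph_closure f g"
proof -
  \<comment> \<open>At this rate the squared distances of the images are at most \<open>(1/4)\<^sup>n\<close>; \<open>\<kappa> + 1\<close> is positive even when \<open>\<kappa> = 0\<close>.\<close>
  define e :: "nat \<Rightarrow> ennreal" where "e n = ennreal ((1/4)^n / (4 * (\<kappa> + 1)))" for n
  have epos: "0 < e n" for n using assms(2) by (simp add: e_def)
  then have "\<forall>n. \<exists>J c. finite J \<and> J \<subseteq> I \<and> L2_normsq M (\<lambda>x. f x - (\<Sum>i\<in>J. c i * a i x)) < e n"
    using approx by blast
  then obtain J c where J: "\<And>n. finite (J n)" "\<And>n. J n \<subseteq> I"
    and close: "\<And>n. L2_normsq M (\<lambda>x. f x - (\<Sum>i\<in>J n. c n i * a i x)) < e n"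
    unfolding choice_iff by blast
  let ?s = "\<lambda>n x. \<Sum>i\<in>J n. c n i * a i x" and ?t = "\<lambda>n x. \<Sum>i\<in>J n. c n i * b i x"
  have emono: "e m \<le> e n" if "n \<le> m" for m n
    unfolding e_def using that assms(2)
    by (intro ennreal_leI divide_right_mono power_decreasing) auto
  have "L2_normsq N (\<lambda>x. ?t m x - ?t n x) \<le> ennreal ((1/4)^n)" if "n \<le> m" for m n
  proof -
    let ?c = "\<lambda>i. (if i \<in> J m then c m i else 0) - (if i \<in> J n then c n i else 0)"
    have eq: "(\<Sum>i\<in>J m \<union> J n. ?c i * z i) = (\<Sum>i\<in>J m. c m i * z i) - (\<Sum>i\<in>J n. c n i * z i)"
      for z :: "'i \<Rightarrow> complex"
    proof -
      have "(\<Sum>i\<in>J m \<union> J n. (if i \<in> J m then c m i else 0) * z i) = (\<Sum>i\<in>J m. c m i * z i)"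
        by (rule sum.mono_neutral_cong_right) (use J in auto)
      moreover have "(\<Sum>i\<in>J m \<union> J n. (if i \<in> J n then c n i else 0) * z i) = (\<Sum>i\<in>J n. c n i * z i)"
        by (rule sum.mono_neutral_cong_right) (use J in auto)
      ultimately show ?thesis by (simp only: ring_distribs sum_subtractf left_diff_distrib)
    qed
    note m = assms(3)[THEN square_integrable_measurable]
      sq_comb[OF J(2), THEN square_integrable_measurable]
    have sub: "i \<in> I" if "i \<in> J m \<union> J n" for i using J that by auto
    have "L2_normsq N (\<lambda>x. ?t m x - ?t n x) = ennreal \<kappa> * L2_normsq M (\<lambda>x. ?s m x - ?s n x)"
      unfolding eq[symmetric]
      by (rule L2_normsq_lincomb_gram) (use sub sq_a sq_b gram assms(2) in \<open>blast+\<close>)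
    also have "\<dots> \<le> ennreal \<kappa> * (2 * L2_normsq M (\<lambda>x. ?s m x - f x) + 2 * L2_normsq M (\<lambda>x. f x - ?s n x))"
      by (intro mult_left_mono L2_normsq_diff_le m) simp
    also have "\<dots> \<le> ennreal \<kappa> * (2 * e n + 2 * e n)"
      using close[of n] close[of m] emono[OF that]
      by (intro mult_left_mono add_mono) (auto simp: L2_normsq_diff_commute[of M f])
    also have "\<dots> = ennreal (\<kappa> * (4 * ((1/4)^n / (4 * (\<kappa> + 1)))))"
    proof -
      have "e n = ennreal ((1/4)^n / (4 * (\<kappa> + 1)))" by (simp add: e_def)
      moreover have "2 * ennreal r + 2 * ennreal r = ennreal (4 * r)" if "0 \<le> r" for r
      proof -
        have "ennreal (4 * r) = ennreal (2 * r + 2 * r)" by simp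
        also have "\<dots> = 2 * ennreal r + 2 * ennreal r"
          using that by (subst ennreal_plus) (auto simp: ennreal_mult)
        finally show ?thesis ..
      qed
      moreover have "0 \<le> (1/4)^n / (4 * (\<kappa> + 1))" using assms(2) by simp
      ultimately show ?thesis using assms(2) by (simp only: ennreal_mult)
    qed
    also have "\<dots> \<le> ennreal ((1/4)^n)"
    proof (rule ennreal_leI)
      have "\<kappa> * (4 * (r / (4 * (\<kappa> + 1)))) = \<kappa> / (\<kappa> + 1) * r" for r
        by (simp only: times_divide_eq_right times_divide_eq_left mult_divide_mult_cancel_left_if) simp
      moreover have "\<kappa> / (\<kappa> + 1) * (1/4)^n \<le> 1 * (1/4)^n"
        using assms(2) by (intro mult_right_mono) auto
      ultimately show "\<kappa> * (4 * ((1/4)^n / (4 * (\<kappa> + 1)))) \<le> (1/4)^n" by simp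
    qed
    finally show ?thesis .
  qed
  then obtain g where g: "L2_tendsto N ?t g"
    using L2_complete[of N ?t] sq_comb(2)[OF J(2)] by blast
  have "(\<lambda>n. (1/4::real)^n) \<longlonglongrightarrow> 0" by (rule LIMSEQ_realpow_zero) auto
  then have "(\<lambda>n. ennreal ((1/4)^n / (4 * (\<kappa> + 1)))) \<longlonglongrightarrow> ennreal (0 / (4 * (\<kappa> + 1)))"
    by (intro tendsto_ennrealI tendsto_divide tendsto_const) (use assms(2) in auto)
  then have "e \<longlonglongrightarrow> 0" unfolding e_def[abs_def] by simp
  then have "(\<lambda>n. L2_normsq M (\<lambda>x. f x - ?s n x)) \<longlonglongrightarrow> 0"
    by (rule tendsto_sandwich[OF _ _ tendsto_const, rotated 2])
       (use close in \<open>auto intro!: always_eventually less_imp_le\<close>)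
  then have "L2_tendsto M ?s f"
    using assms(3) sq_comb(1)[OF J(2)] by (simp add: L2_tendsto_def)
  then have "graph_closure f g"
    using g by (rule graph_closure_tendsto[OF graph_closure_lincomb[OF J]])
  then show ?thesis by blast
qed

end

text \<open>
  The definition of the closed span combines functions, whereas families are combined along
  their indices: one index is chosen for every function, or the coefficients of equal members
  are added up.
\<close>

lemma closed_span_image_iff:
  "f \<in> closed_span M (a ` I) \<longleftrightarrow> square_integrable M f \<and>
     (\<forall>\<epsilon>>0. \<exists>J c. finite J \<and> J \<subseteq> I \<and> L2_normsq M (\<lambda>x. f x - (\<Sum>i\<in>J. c i * a i x)) < \<epsilon>)"
proof -
  have 1: "\<exists>J c. finite J \<and> J \<subseteq> I \<and> L2_normsq M (\<lambda>x. f x - (\<Sum>i\<in>J. c i * a i x)) < \<epsilon>"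
    if t: "finite F" "F \<subseteq> a ` I" "L2_normsq M (\<lambda>x. f x - (\<Sum>b\<in>F. c b * b x)) < \<epsilon>" for \<epsilon> F c
  proof -
    obtain J where J: "J \<subseteq> I" "inj_on a J" "F = a ` J"
      using t(2) by (auto simp: subset_image_inj)
    have "(\<Sum>b\<in>F. c b * b x) = (\<Sum>i\<in>J. c (a i) * a i x)" for x
      using J by (simp add: sum.reindex)
    then show ?thesis
      using that J by (intro exI[of _ J] exI[of _ "\<lambda>i. c (a i)"]) (auto simp: finite_image_iff)
  qed
  have 2: "\<exists>F c. finite F \<and> F \<subseteq> a ` I \<and> L2_normsq M (\<lambda>x. f x - (\<Sum>b\<in>F. c b * b x)) < \<epsilon>"
    if "finite J" "J \<subseteq> I" "L2_normsq M (\<lambda>x. f x - (\<Sum>i\<in>J. c i * a i x)) < \<epsilon>" for \<epsilon> J c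
  proof -
    have "(\<Sum>i\<in>J. c i * a i x) = (\<Sum>b\<in>a ` J. (\<Sum>i | i \<in> J \<and> a i = b. c i) * b x)" for x
      using that(1) by (subst sum.image_gen[where g=a])
        (auto simp: sum_distrib_right intro!: sum.cong)
    then show ?thesis
      using that by (intro exI[of _ "a ` J"] exI[of _ "\<lambda>b. \<Sum>i | i \<in> J \<and> a i = b. c i"]) auto
  qed
  show ?thesis unfolding closed_span_def using 1 2 by (auto; metis)
qed

lemma (in L2_families) graph_closure_imp_closed_span: "graph_closure f g \<Longrightarrow> g \<in> closed_span N (b ` I)"
  unfolding graph_closure_def closed_span_image_iff by blast

lemma closed_span_eq_graph_closure:
  assumes "\<And>i. i \<in> I \<Longrightarrow> square_integrable M (a i)"
  shows "f \<in> closed_span M (a ` I) \<longleftrightarrow> L2_families.graph_closure M M a a I f f"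
proof -
  interpret L2_families M M a a I by unfold_locales (fact assms)+
  show ?thesis by (simp add: closed_span_image_iff graph_closure_def)
qed

lemma closed_span_sq: "f \<in> closed_span M A \<Longrightarrow> square_integrable M f"
  by (simp add: closed_span_def)

text \<open>A contraction that is a multiplication maps approximations to approximations.\<close>

lemma closed_span_mult:
  assumes f: "f \<in> closed_span M (a ` I)"
    and sq: "\<And>i. i \<in> I \<Longrightarrow> square_integrable M (a i)"
    and [measurable]: "w \<in> borel_measurable M" "sets N = sets M"
    and bound: "\<And>h. h \<in> borel_measurable M \<Longrightarrow> L2_normsq N (\<lambda>x. w x * h x) \<le> L2_normsq M h"
  shows "(\<lambda>x. w x * f x) \<in> closed_span N ((\<lambda>i x. w x * a i x) ` I)"
proof -
  have [measurable]: "f \<in> borel_measurable M"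
    using f by (auto intro: square_integrable_measurable closed_span_sq)
  have mN: "borel_measurable N = (borel_measurable M :: ('a \<Rightarrow> complex) set)"
    by (rule measurable_cong_sets) (use assms(4) in auto)
  have "square_integrable N (\<lambda>x. w x * f x)"
    unfolding square_integrable_iff_normsq_finite mN
    using closed_span_sq[OF f] bound[of f] by (auto simp: square_integrable_iff_normsq_finite intro: le_less_trans)
  moreover have "\<exists>J c. finite J \<and> J \<subseteq> I \<and>
      L2_normsq N (\<lambda>x. w x * f x - (\<Sum>i\<in>J. c i * (w x * a i x))) < \<epsilon>" if eps: "0 < \<epsilon>" for \<epsilon>
  proof -
    obtain J c where J: "finite J" "J \<subseteq> I" "L2_normsq M (\<lambda>x. f x - (\<Sum>i\<in>J. c i * a i x)) < \<epsilon>"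
      using f eps unfolding closed_span_image_iff by blast
    have "L2_normsq N (\<lambda>x. w x * f x - (\<Sum>i\<in>J. c i * (w x * a i x)))
        = L2_normsq N (\<lambda>x. w x * (f x - (\<Sum>i\<in>J. c i * a i x)))"
      by (simp add: right_diff_distrib sum_distrib_left mult_ac)
    also have "\<dots> \<le> L2_normsq M (\<lambda>x. f x - (\<Sum>i\<in>J. c i * a i x))"
      using J(2) sq by (intro bound borel_measurable_diff square_integrable_measurable[OF square_integrable_lincomb])
         (auto intro: square_integrable_measurable)
    finally show ?thesis using J by (auto intro: le_less_trans)
  qed
  ultimately show ?thesis unfolding closed_span_image_iff by blast
qed

section \<open>Density of step functions\<close>

abbreviation intervals :: "(real \<times> real) set" where
  "intervals \<equiv> {(p, q). p < q}"

definition ivl_ind :: "real \<times> real \<Rightarrow> real \<Rightarrow> complex" where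
  "ivl_ind I = indicator {fst I<..snd I}"

lemma measurable_ivl_ind [measurable]: "ivl_ind I \<in> borel_measurable borel"
  unfolding ivl_ind_def by measurable

lemma square_integrable_indicator:
  assumes "A \<in> sets M" "emeasure M A < \<infinity>"
  shows "square_integrable M (indicator A)"
proof -
  have "L2_normsq M (indicator A) = (\<integral>\<^sup>+x. indicator A x \<partial>M)"
    unfolding L2_normsq_def by (intro nn_integral_cong) (auto split: split_indicator)
  then show ?thesis
    using assms by (auto simp: square_integrable_iff_normsq_finite)
qed

lemma emeasure_lborel_Ioc_finite: "emeasure lborel {p<..q::real} < \<infinity>"
  by (cases "p \<le> q") auto

lemma square_integrable_ivl_ind: "square_integrable lborel (ivl_ind I)"
  unfolding ivl_ind_def
  by (rule square_integrable_indicator) (auto simp: emeasure_lborel_Ioc_finite[simplified])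

interpretation steps: L2_families lborel lborel ivl_ind ivl_ind intervals
  by unfold_locales (rule square_integrable_ivl_ind)+

text \<open>
  Dynkin's argument. Cutting off to a fixed window keeps all indicators, in particular that of
  the complement, square-integrable.
\<close>

lemma bounded_indicator_in_step_closure:
  fixes n :: nat
  assumes "A \<in> sets borel"
  shows "steps.graph_closure (indicator (A \<inter> {- real n<..real n})) (indicator (A \<inter> {- real n<..real n}))"
proof -
  let ?J = "{- real n<..real n}"
  let ?C = "\<lambda>A. steps.graph_closure (indicator (A \<inter> ?J)) (indicator (A \<inter> ?J))"
  let ?G = "range (\<lambda>(p, q). {p<..q::real})"
  have zero: "steps.graph_closure (\<lambda>_. 0) (\<lambda>_. 0)"
    using steps.graph_closure_lincomb[of "{}"] by simp
  have ivl: "?C {p<..q}" for p q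
  proof -
    have eq: "{p<..q} \<inter> ?J = {max p (- real n)<..min q (real n)}" by auto
    show ?thesis
    proof (cases "max p (- real n) < min q (real n)")
      case True
      then have "(max p (- real n), min q (real n)) \<in> intervals" by simp
      from steps.graph_closure_base[OF this] show ?thesis
        unfolding eq by (simp add: ivl_ind_def)
    next
      case False
      then have "indicator ({p<..q} \<inter> ?J) = (\<lambda>_. 0 :: complex)"
        unfolding eq by (auto simp: fun_eq_iff split: split_indicator)
      then show ?thesis using zero by simp
    qed
  qed
  have "Int_stable ?G"
  proof (rule Int_stableI)
    fix A B assume "A \<in> ?G" "B \<in> ?G"
    then obtain p q p' q' where "A = {p<..q}" "B = {p'<..q'}" by auto
    then have "A \<inter> B = (\<lambda>(p, q). {p<..q}) (max p p', min q q')" by auto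
    then show "A \<inter> B \<in> ?G" by blast
  qed
  moreover have "?G \<subseteq> Pow UNIV" by simp
  moreover have "A \<in> sigma_sets UNIV ?G"
    using assms by (simp add: borel_sigma_sets_Ioc)
  ultimately show ?thesis
  proof (induction rule: sigma_sets_induct_disjoint)
    case (basic A)
    then show ?case using ivl by auto
  next
    case empty
    show ?case using zero by (simp add: indicator_def[abs_def])
  next
    case (compl A)
    have eq: "indicator ((UNIV - A) \<inter> ?J) = (\<lambda>x. indicator ({- real n<..real n} \<inter> ?J) x - indicator (A \<inter> ?J) x :: complex)"
      by (auto simp: fun_eq_iff split: split_indicator)
    show ?case unfolding eq using compl ivl by (intro steps.graph_closure_diff)
  next
    case (union A)
    have [measurable]: "A i \<in> sets borel" for i
      using union by (auto simp: borel_sigma_sets_Ioc)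
    have partial: "steps.graph_closure (indicator ((\<Union>i<k. A i) \<inter> ?J)) (indicator ((\<Union>i<k. A i) \<inter> ?J))" for k
    proof (induction k)
      case 0
      then show ?case using zero by (simp add: indicator_def[abs_def])
    next
      case (Suc k)
      have "A i \<inter> A k = {}" if "i < k" for i
        using union(1) that unfolding disjoint_family_on_def by auto
      then have eq: "indicator ((\<Union>i<Suc k. A i) \<inter> ?J)
          = (\<lambda>x. indicator ((\<Union>i<k. A i) \<inter> ?J) x + indicator (A k \<inter> ?J) x :: complex)"
        by (auto simp: fun_eq_iff lessThan_Suc split: split_indicator)
      show ?case unfolding eq using Suc union by (intro steps.graph_closure_add)
    qed
    have "L2_tendsto lborel (\<lambda>k. indicator ((\<Union>i<k. A i) \<inter> ?J)) (indicator ((\<Union>i. A i) \<inter> ?J))"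
    proof (rule L2_dominated_convergence[where w="indicator ?J"])
      have "(\<lambda>x. (indicator ?J x :: real)\<^sup>2) = indicator ?J"
        by (auto simp: fun_eq_iff split: split_indicator)
      then show "integrable lborel (\<lambda>x. (indicator ?J x :: real)\<^sup>2)"
        by (simp add: emeasure_lborel_Ioc_finite[simplified])
      show "AE x in lborel. (\<lambda>k. indicator ((\<Union>i<k. A i) \<inter> ?J) x) \<longlonglongrightarrow> (indicator ((\<Union>i. A i) \<inter> ?J) x :: complex)"
      proof (rule AE_I2)
        fix x
        show "(\<lambda>k. indicator ((\<Union>i<k. A i) \<inter> ?J) x) \<longlonglongrightarrow> (indicator ((\<Union>i. A i) \<inter> ?J) x :: complex)"
        proof (cases "\<exists>i. x \<in> A i")
          case True
          then obtain i where "x \<in> A i" ..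
          then have "\<forall>\<^sub>F k in sequentially. indicator ((\<Union>i<k. A i) \<inter> ?J) x = (indicator ((\<Union>i. A i) \<inter> ?J) x :: complex)"
            by (intro eventually_sequentiallyI[of "Suc i"]) (auto split: split_indicator)
          then show ?thesis by (rule tendsto_eventually)
        next
          case False
          then show ?thesis by (auto simp: indicator_def)
        qed
      qed
    qed (auto split: split_indicator)
    from steps.graph_closure_tendsto[OF partial this this] show ?case .
  qed
qed

text \<open>
  Approximating simple functions are cut off to growing windows, which leaves finitely many level
  sets of finite measure.
\<close>

lemma step_functions_dense:
  assumes "square_integrable lborel f"
  shows "steps.graph_closure f f"
proof -
  have fm: "f \<in> borel_measurable lborel" using assms by (rule square_integrable_measurable)
  obtain F where F: "\<And>i. simple_function lborel (F i)" "\<And>x. (\<lambda>i. F i x) \<longlonglongrightarrow> f x"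
    "\<And>i x. cmod (F i x) \<le> 2 * cmod (f x)"
    using borel_measurable_implies_sequence_metric[OF fm, of 0] by (auto simp: dist_norm)
  have [measurable]: "F i \<in> borel_measurable borel" for i
    using borel_measurable_simple_function[OF F(1)] by simp
  define s where "s i x = indicator {- real i<..real i} x * F i x" for i x
  have [measurable]: "s i \<in> borel_measurable borel" for i unfolding s_def by measurable
  have "steps.graph_closure (s i) (s i)" for i
  proof -
    let ?J = "{- real i<..real i}"
    have fin: "finite (range (F i))" using F(1)[of i] by (simp add: simple_function_def)
    have meas: "F i -` {y} \<in> sets borel" for y
      using simple_functionD(2)[OF F(1)[of i], of "{y}"] by simp
    have eq: "s i = (\<lambda>x. \<Sum>y\<in>range (F i). y * indicator (F i -` {y} \<inter> ?J) x)"
    proof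
      fix x
      have "(\<Sum>y\<in>range (F i). y * indicator (F i -` {y} \<inter> ?J) x)
          = (\<Sum>y\<in>range (F i). if y = F i x then F i x * indicator ?J x else 0)"
        by (intro sum.cong) (auto split: split_indicator)
      also have "\<dots> = s i x" using fin by (simp add: s_def mult.commute)
      finally show "s i x = (\<Sum>y\<in>range (F i). y * indicator (F i -` {y} \<inter> ?J) x)" ..
    qed
    have "steps.graph_closure (\<lambda>x. \<Sum>y\<in>Y. y * indicator (F i -` {y} \<inter> ?J) x)
      (\<lambda>x. \<Sum>y\<in>Y. y * indicator (F i -` {y} \<inter> ?J) x)" if "finite Y" for Y
      using that
    proof (induction Y)
      case empty
      show ?case using steps.graph_closure_lincomb[of "{}"] by simp
    next
      case (insert y Y)
      show ?case
        unfolding sum.insert[OF insert(1,2)]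
        by (intro steps.graph_closure_add steps.graph_closure_cmult bounded_indicator_in_step_closure
          meas insert)
    qed
    from this[OF fin] show ?thesis unfolding eq .
  qed
  moreover have "L2_tendsto lborel s f"
  proof (rule L2_dominated_convergence[where w="\<lambda>x. 2 * cmod (f x)"])
    show "integrable lborel (\<lambda>x. (2 * cmod (f x))\<^sup>2)"
      using assms by (simp add: square_integrable_def power_mult_distrib)
    show "AE x in lborel. (\<lambda>i. s i x) \<longlonglongrightarrow> f x"
    proof (rule AE_I2)
      fix x
      obtain n :: nat where n: "\<bar>x\<bar> < real n" using reals_Archimedean2 by blast
      have "\<forall>\<^sub>F i in sequentially. F i x = s i x"
        using n by (intro eventually_sequentiallyI[of n]) (auto simp: s_def split: split_indicator)
      from Lim_transform_eventually[OF F(2) this] show "(\<lambda>i. s i x) \<longlonglongrightarrow> f x" .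
    qed
    show "AE x in lborel. cmod (s i x) \<le> 2 * cmod (f x)" for i
      using F(3)[of i] by (intro AE_I2) (auto simp: s_def split: split_indicator)
  qed (use fm in auto)
  ultimately show ?thesis using steps.graph_closure_tendsto by blast
qed

text \<open>Such a function is orthogonal to the step functions that approximate it, hence to itself.\<close>

lemma L2_orthogonal_to_intervals:
  assumes f: "square_integrable lborel f"
    and 0: "\<And>p q. p < q \<Longrightarrow> L2_inner lborel f (ivl_ind (p, q)) = 0"
  shows "AE x in lborel. f x = 0"
proof -
  obtain J c where J: "\<And>n::nat. finite (J n)" "\<And>n. J n \<subseteq> intervals"
    and lim: "L2_tendsto lborel (\<lambda>n x. \<Sum>i\<in>J n. c n i * ivl_ind i x) f"
    using steps.graph_closure_sequence[OF step_functions_dense[OF f]] by blast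
  have "L2_inner lborel f (\<lambda>x. \<Sum>i\<in>J n. c n i * ivl_ind i x) = 0" for n
    using J(2)[of n] f 0
    by (subst L2_inner_lincomb_right) (auto simp: square_integrable_ivl_ind intro!: sum.neutral)
  moreover have "L2_tendsto lborel (\<lambda>_. f) f"
    using f by (simp add: L2_tendsto_def L2_normsq_def)
  ultimately have "(\<lambda>_::nat. 0) \<longlonglongrightarrow> L2_inner lborel f f"
    using L2_inner_tendsto[OF _ lim, of "\<lambda>_. f" f] by simp
  then have "L2_inner lborel f f = 0" by (simp add: LIMSEQ_const_iff)
  then show ?thesis by (rule L2_inner_self_eq_0_AE[OF f])
qed

section \<open>Fourier transforms of integrable functions\<close>

definition fourier :: "(real \<Rightarrow> complex) \<Rightarrow> real \<Rightarrow> complex" where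
  "fourier h u = (CLBINT t. h t * iexp (t * u))"

lemma measurable_fourier [measurable]:
  assumes [measurable]: "h \<in> borel_measurable borel"
  shows "fourier h \<in> borel_measurable borel"
  unfolding fourier_def by measurable

lemma integrable_mult_iexp:
  "integrable lborel h \<Longrightarrow> integrable lborel (\<lambda>t. h t * iexp (t * u))"
  by (rule Bochner_Integration.integrable_bound[of _ h]) (auto simp: norm_mult)

lemma cmod_fourier_le: "cmod (fourier h u) \<le> (LBINT t. cmod (h t))"
  unfolding fourier_def using integral_norm_bound[of lborel "\<lambda>t. h t * iexp (t * u)"]
  by (simp add: norm_mult)

lemma fourier_exchange:
  assumes h: "integrable lborel h" and k: "integrable lborel k"
  shows "(CLBINT u. fourier h u * k u) = (CLBINT t. h t * fourier k t)"
proof -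
  have [measurable]: "h \<in> borel_measurable borel" "k \<in> borel_measurable borel"
    using h k by auto
  have "integrable (lborel \<Otimes>\<^sub>M lborel) (\<lambda>(t, u). h t * iexp (t * u) * k u)"
  proof (rule lborel_pair.Fubini_integrable)
    have "integrable lborel (\<lambda>t. cmod (h t) * (LBINT u. cmod (k u)))"
      using h by auto
    then show "integrable lborel (\<lambda>t. LBINT u. norm (case (t, u) of (t, u) \<Rightarrow> h t * iexp (t * u) * k u))"
      by (simp add: norm_mult)
    have "integrable lborel (\<lambda>u. h t * (k u * iexp (u * t)))" for t
      by (intro integrable_mult_right integrable_mult_iexp k)
    then show "AE t in lborel. integrable lborel (\<lambda>u. case (t, u) of (t, u) \<Rightarrow> h t * iexp (t * u) * k u)"
      by (simp add: mult_ac)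
  qed simp
  from lborel_pair.Fubini_integral[OF this]
  have "(CLBINT u. (CLBINT t. h t * iexp (t * u) * k u)) = (CLBINT t. (CLBINT u. h t * iexp (t * u) * k u))" .
  moreover have "(CLBINT t. h t * iexp (t * u) * k u) = fourier h u * k u" for u
    unfolding fourier_def by simp
  moreover have "(CLBINT u. h t * iexp (t * u) * k u) = h t * fourier k t" for t
    unfolding fourier_def by (subst integral_mult_right_zero[symmetric]) (simp add: mult_ac)
  ultimately show ?thesis by (simp only:)
qed

lemma integrable_ivl_ind: "integrable lborel (ivl_ind I)"
proof -
  have "(\<lambda>x. ivl_ind I x * cnj (ivl_ind I x)) = ivl_ind I"
    by (auto simp: ivl_ind_def fun_eq_iff split: split_indicator)
  then show ?thesis
    using integrable_L2_inner[OF square_integrable_ivl_ind square_integrable_ivl_ind, of I I] by simp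
qed

lemma fourier_ivl_ind:
  assumes "p \<le> q" "u \<noteq> 0"
  shows "fourier (ivl_ind (p, q)) u = (iexp (q * u) - iexp (p * u)) / (\<i> * u)"
proof -
  have "fourier (ivl_ind (p, q)) u = (CLBINT t. indicator {p..q} t *\<^sub>R iexp (t * u))"
    unfolding fourier_def ivl_ind_def
  proof (rule integral_cong_AE)
    show "AE t in lborel. indicator {fst (p, q)<..snd (p, q)} t * iexp (t * u) = indicator {p..q} t *\<^sub>R iexp (t * u)"
      using AE_lborel_singleton[of p] by eventually_elim (auto split: split_indicator)
  qed measurable
  also have "\<dots> = iexp (q * u) / (\<i> * u) - iexp (p * u) / (\<i> * u)"
  proof (rule integral_FTC_atLeastAtMost[OF assms(1)])
    show "((\<lambda>x. iexp (x * u) / (\<i> * u)) has_vector_derivative iexp (x * u)) (at x within {p..q})" for x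
      using assms(2)
      by (auto intro!: derivative_eq_intros has_vector_derivative_real_field simp: field_simps)
  qed (intro continuous_intros)
  finally show ?thesis by (simp add: diff_divide_distrib)
qed

text \<open>
  Levy's inversion formula for the uniform distribution on an interval is already
  Parseval's identity for two indicator functions: the characteristic function is a transformed
  indicator, and the kernel of the formula is the conjugate of the other one.
\<close>

lemma fourier_intervals_truncated_inner:
  assumes "p < q" "r < s"
  shows "(\<lambda>T::nat. CLBINT u. indicator {- real T<..<real T} u *
      (fourier (ivl_ind (p, q)) u * cnj (fourier (ivl_ind (r, s)) u)))
    \<longlonglongrightarrow> 2 * pi * measure lborel ({p<..q} \<inter> {r<..s})"
proof -
  define d where "d x = indicator {p<..q} x / (q - p)" for x :: real
  define M where "M = density lborel (\<lambda>x. ennreal (d x))"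
  have [measurable]: "d \<in> borel_measurable borel" unfolding d_def by measurable
  have d0: "0 \<le> d x" for x using assms by (simp add: d_def)
  have em: "emeasure M A = ennreal (measure lborel ({p<..q} \<inter> A) / (q - p))" if "A \<in> sets borel" for A
  proof -
    have fin: "emeasure lborel ({p<..q} \<inter> A) < \<infinity>"
      using that by (intro le_less_trans[OF emeasure_mono emeasure_lborel_Ioc_finite[of p q]]) auto
    have "emeasure M A = (\<integral>\<^sup>+x. ennreal (1 / (q - p)) * indicator ({p<..q} \<inter> A) x \<partial>lborel)"
      unfolding M_def using that
      by (subst emeasure_density) (auto intro!: nn_integral_cong simp: d_def split: split_indicator)
    also have "\<dots> = ennreal (1 / (q - p)) * emeasure lborel ({p<..q} \<inter> A)"
      using that by (subst nn_integral_cmult) auto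
    also have "\<dots> = ennreal (measure lborel ({p<..q} \<inter> A) / (q - p))"
      using fin assms by (subst emeasure_eq_ennreal_measure) (auto simp: ennreal_mult[symmetric])
    finally show ?thesis .
  qed
  have ms: "measure M A = measure lborel ({p<..q} \<inter> A) / (q - p)" if "A \<in> sets borel" for A
    using em[OF that] assms by (simp add: measure_def)
  have "prob_space M"
    by (rule prob_spaceI) (use em[of UNIV] assms in \<open>simp add: M_def\<close>)
  then interpret M: real_distribution M
    by (intro real_distribution.intro real_distribution_axioms.intro) (simp_all add: M_def)
  have char: "char M u = fourier (ivl_ind (p, q)) u / (q - p)" for u
  proof -
    have "char M u = (CLBINT x. d x *\<^sub>R iexp (u * x))"
      unfolding char_def M_def by (subst integral_density) (auto simp: d0)
    also have "\<dots> = (CLBINT x. ivl_ind (p, q) x * iexp (x * u) / (q - p))"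
      by (intro Bochner_Integration.integral_cong)
         (auto simp: d_def ivl_ind_def mult.commute scaleR_conv_of_real split: split_indicator)
    also have "\<dots> = fourier (ivl_ind (p, q)) u / (q - p)"
      unfolding fourier_def by simp
    finally show ?thesis .
  qed
  have atom: "measure M {x} = 0" for x
  proof -
    have "measure lborel ({p<..q} \<inter> {x}) = 0"
      using emeasure_mono[of "{p<..q} \<inter> {x}" "{x}" lborel] by (auto simp: measure_def)
    then show ?thesis by (subst ms) auto
  qed
  let ?K = "\<lambda>u. (iexp (- (u * r)) - iexp (- (u * s))) / (\<i> * u)"
  have "(\<lambda>T::nat. 1 / (2 * pi) * (CLBINT u=- real T..real T. ?K u * char M u)) \<longlonglongrightarrow> measure M {r<..s}"
    using M.Levy_Inversion[OF less_imp_le[OF assms(2)] atom atom]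
    unfolding of_int_minus of_int_of_nat_eq .
  then have lim: "(\<lambda>T::nat. (2 * pi * (q - p)) * (1 / (2 * pi) * (CLBINT u=- real T..real T. ?K u * char M u)))
      \<longlonglongrightarrow> of_real (2 * pi * (q - p)) * of_real (measure M {r<..s})"
    by (intro tendsto_mult tendsto_const)
  have "(2 * pi * (q - p)) * (1 / (2 * pi) * (CLBINT u=- real T..real T. ?K u * char M u))
      = (CLBINT u. indicator {- real T<..<real T} u *
      (fourier (ivl_ind (p, q)) u * cnj (fourier (ivl_ind (r, s)) u)))" for T :: nat
  proof -
    have "(CLBINT u=- real T..real T. ?K u * char M u) = (CLBINT u. indicator {- real T<..<real T} u *\<^sub>R (?K u * char M u))"
      by (simp add: interval_lebesgue_integral_def set_lebesgue_integral_def)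
    also have "\<dots> = (CLBINT u. indicator {- real T<..<real T} u *
      (fourier (ivl_ind (p, q)) u * cnj (fourier (ivl_ind (r, s)) u)) / (q - p))"
    proof (rule integral_cong_AE)
      show "AE u in lborel. indicator {- real T<..<real T} u *\<^sub>R (?K u * char M u)
        = indicator {- real T<..<real T} u *
          (fourier (ivl_ind (p, q)) u * cnj (fourier (ivl_ind (r, s)) u)) / (q - p)"
        using AE_lborel_singleton[of 0]
      proof eventually_elim
        case (elim u)
        have "?K u = cnj (fourier (ivl_ind (r, s)) u)"
          using assms elim by (subst fourier_ivl_ind) (auto simp: exp_cnj field_simps)
        then show ?case by (simp add: char split: split_indicator)
      qed
      show "(\<lambda>u. indicator {- real T<..<real T} u *\<^sub>R (?K u * char M u)) \<in> borel_measurable lborel"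
        using M.char_measurable by measurable
    qed (measurable)
    also have "\<dots> = (CLBINT u. indicator {- real T<..<real T} u *
      (fourier (ivl_ind (p, q)) u * cnj (fourier (ivl_ind (r, s)) u))) / (q - p)"
      by simp
    finally have *: "(CLBINT u=- real T..real T. ?K u * char M u) = (CLBINT u. indicator {- real T<..<real T} u *
      (fourier (ivl_ind (p, q)) u * cnj (fourier (ivl_ind (r, s)) u))) / (q - p)" .
    have "of_real (2 * pi * (q - p)) * (of_real (1 / (2 * pi)) * (R / of_real (q - p))) = R" for R :: complex
      using assms by simp
    then show ?thesis unfolding * .
  qed
  moreover have "(2 * pi * (q - p)) * measure M {r<..s} = 2 * pi * measure lborel ({p<..q} \<inter> {r<..s})"
    using assms by (subst ms) (auto simp: field_simps)
  ultimately show ?thesis using lim by (simp only: of_real_mult[symmetric])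
qed

text \<open>
  For two equal intervals the truncated integrands are nonnegative and increasing, and their
  integrals converge.
\<close>

lemma square_integrable_fourier_ivl_ind:
  assumes "I \<in> intervals"
  shows "square_integrable lborel (fourier (ivl_ind I))"
proof -
  obtain p q where I: "I = (p, q)" "p < q" using assms by auto
  let ?F = "fourier (ivl_ind I)"
  let ?B = "LBINT t. cmod (ivl_ind I t)"
  let ?f = "\<lambda>(T::nat) u. indicator {- real T<..<real T} u * (cmod (?F u))\<^sup>2"
  have "integrable lborel (\<lambda>u. (cmod (?F u))\<^sup>2)"
  proof (rule integrable_monotone_convergence)
    show "integrable lborel (?f T)" for T
    proof (rule Bochner_Integration.integrable_bound)
      show "integrable lborel (\<lambda>u. indicator {- real T<..<real T} u * ?B\<^sup>2)" by simp
      show "AE u in lborel. norm (?f T u) \<le> norm (indicator {- real T<..<real T} u * ?B\<^sup>2)"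
        using cmod_fourier_le[of "ivl_ind I"]
        by (intro AE_I2) (auto intro!: power_mono split: split_indicator)
    qed measurable
    show "AE u in lborel. mono (\<lambda>T. ?f T u)"
      by (intro AE_I2 monoI) (auto split: split_indicator)
    show "AE u in lborel. (\<lambda>T. ?f T u) \<longlonglongrightarrow> (cmod (?F u))\<^sup>2"
    proof (rule AE_I2)
      fix u :: real
      obtain n :: nat where "\<bar>u\<bar> < real n" using reals_Archimedean2 by blast
      then show "(\<lambda>T. ?f T u) \<longlonglongrightarrow> (cmod (?F u))\<^sup>2"
        by (intro tendsto_eventually eventually_sequentiallyI[of n]) (auto split: split_indicator)
    qed
    have "(\<lambda>T. Re (CLBINT u. indicator {- real T<..<real T} u * (?F u * cnj (?F u))))
      \<longlonglongrightarrow> Re (2 * pi * measure lborel ({p<..q} \<inter> {p<..q}))"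
      unfolding I(1) by (intro tendsto_Re fourier_intervals_truncated_inner I)
    moreover have "Re (CLBINT u. indicator {- real T<..<real T} u * (?F u * cnj (?F u))) = (LBINT u. ?f T u)" for T
    proof -
      have "(CLBINT u. indicator {- real T<..<real T} u * (?F u * cnj (?F u))) = (CLBINT u. of_real (?f T u))"
        by (intro Bochner_Integration.integral_cong refl)
           (simp only: of_real_mult complex_norm_square, simp split: split_indicator)
      then show ?thesis by (simp only: integral_complex_of_real Re_complex_of_real)
    qed
    ultimately show "(\<lambda>T. LBINT u. ?f T u) \<longlonglongrightarrow> Re (2 * pi * measure lborel ({p<..q} \<inter> {p<..q}))"
      by simp
  qed measurable
  then show ?thesis by (simp add: square_integrable_def)
qed

lemma L2_inner_ivl_ind:
  "L2_inner lborel (ivl_ind (p, q)) (ivl_ind (r, s)) = measure lborel ({p<..q} \<inter> {r<..s})"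
proof -
  have "L2_inner lborel (ivl_ind (p, q)) (ivl_ind (r, s))
      = (CLBINT x. of_real (indicator ({p<..q} \<inter> {r<..s}) x))"
    unfolding L2_inner_def ivl_ind_def
    by (intro Bochner_Integration.integral_cong) (auto split: split_indicator)
  then show ?thesis by (simp only: integral_complex_of_real) simp
qed

text \<open>Square-integrability makes the product integrable, so the truncation can be removed.\<close>

lemma fourier_ivl_ind_parseval:
  assumes "I \<in> intervals" "J \<in> intervals"
  shows "L2_inner lborel (fourier (ivl_ind I)) (fourier (ivl_ind J)) = of_real (2 * pi) * L2_inner lborel (ivl_ind I) (ivl_ind J)"
proof -
  obtain p q r s where IJ: "I = (p, q)" "p < q" "J = (r, s)" "r < s" using assms by auto
  let ?g = "\<lambda>u. fourier (ivl_ind I) u * cnj (fourier (ivl_ind J) u)"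
  have g: "integrable lborel ?g"
    by (intro integrable_L2_inner square_integrable_fourier_ivl_ind assms)
  have "(\<lambda>T::nat. CLBINT u. indicator {- real T<..<real T} u * ?g u) \<longlonglongrightarrow> (CLBINT u. ?g u)"
  proof (rule integral_dominated_convergence)
    show "integrable lborel (\<lambda>u. cmod (?g u))" using g by simp
    show "AE u in lborel. (\<lambda>T::nat. indicator {- real T<..<real T} u * ?g u) \<longlonglongrightarrow> ?g u"
    proof (rule AE_I2)
      fix u :: real
      obtain n :: nat where "\<bar>u\<bar> < real n" using reals_Archimedean2 by blast
      then show "(\<lambda>T::nat. indicator {- real T<..<real T} u * ?g u) \<longlonglongrightarrow> ?g u"
        by (intro tendsto_eventually eventually_sequentiallyI[of n]) (auto split: split_indicator)
    qed
    show "AE u in lborel. norm (indicator {- real T<..<real T} u * ?g u) \<le> cmod (?g u)" for T :: nat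
      by (intro AE_I2) (auto split: split_indicator)
  qed measurable
  with fourier_intervals_truncated_inner[OF IJ(2,4)]
  have "(CLBINT u. ?g u) = 2 * pi * measure lborel ({p<..q} \<inter> {r<..s})"
    unfolding IJ by (rule LIMSEQ_unique[rotated])
  then show ?thesis unfolding L2_inner_def[of _ "fourier _"] unfolding IJ L2_inner_ivl_ind by simp
qed

section \<open>Plancherel's theorem\<close>

abbreviation ivl_fourier :: "real \<times> real \<Rightarrow> real \<Rightarrow> complex" where
  "ivl_fourier I \<equiv> fourier (ivl_ind I)"

abbreviation ivl_fourier_inv :: "real \<times> real \<Rightarrow> real \<Rightarrow> complex" where
  "ivl_fourier_inv I \<equiv> (\<lambda>u. cnj (fourier (ivl_ind I) u))"

text \<open>
  The graphs of the transform and of its adjoint, generated by the indicators of intervals.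
\<close>

interpretation ft: L2_families lborel lborel ivl_ind ivl_fourier intervals
  by unfold_locales (rule square_integrable_ivl_ind, rule square_integrable_fourier_ivl_ind)

interpretation fti: L2_families lborel lborel ivl_ind ivl_fourier_inv intervals
  by unfold_locales (rule square_integrable_ivl_ind, rule square_integrable_cnj, rule square_integrable_fourier_ivl_ind)

lemma cnj_ivl_ind [simp]: "cnj (ivl_ind I x) = ivl_ind I x"
  by (simp add: ivl_ind_def split: split_indicator)

lemma L2_inner_cnj: "L2_inner M (\<lambda>x. cnj (f x)) (\<lambda>x. cnj (g x)) = cnj (L2_inner M f g)"
  unfolding L2_inner_def by (subst Bochner_Integration.integral_cnj[symmetric]) simp

lemma L2_fourier_parseval:
  "ft.graph_closure h F \<Longrightarrow> ft.graph_closure k G \<Longrightarrow>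
    L2_inner lborel F G = of_real (2 * pi) * L2_inner lborel h k"
  by (rule graph_closure_inner[OF ft.L2_families_axioms ft.L2_families_axioms _ _ fourier_ivl_ind_parseval])

lemma fourier_inv_intervals_parseval:
  assumes "I \<in> intervals" "J \<in> intervals"
  shows "L2_inner lborel (ivl_fourier_inv I) (ivl_fourier_inv J) = of_real (2 * pi) * L2_inner lborel (ivl_ind I) (ivl_ind J)"
proof -
  have "cnj (L2_inner lborel (ivl_ind I) (ivl_ind J)) = L2_inner lborel (ivl_ind I) (ivl_ind J)"
    by (cases I; cases J) (simp add: L2_inner_ivl_ind)
  then show ?thesis using assms by (simp add: L2_inner_cnj fourier_ivl_ind_parseval)
qed

lemma L2_fourier_exists:
  assumes "square_integrable lborel h"
  shows "\<exists>F. ft.graph_closure h F" "\<exists>F. fti.graph_closure h F"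
proof -
  have approx: "\<exists>J c. finite J \<and> J \<subseteq> intervals \<and>
      L2_normsq lborel (\<lambda>x. h x - (\<Sum>i\<in>J. c i * ivl_ind i x)) < \<epsilon>" if "0 < \<epsilon>" for \<epsilon>
    using step_functions_dense[OF assms] that unfolding steps.graph_closure_def by blast
  have "0 \<le> 2 * pi" by simp
  show "\<exists>F. ft.graph_closure h F"
    by (rule ft.graph_closure_extension[OF fourier_ivl_ind_parseval \<open>0 \<le> 2 * pi\<close>])
       (use assms approx in auto)
  show "\<exists>F. fti.graph_closure h F"
    by (rule fti.graph_closure_extension[OF fourier_inv_intervals_parseval \<open>0 \<le> 2 * pi\<close>])
       (use assms approx in auto)
qed

text \<open>For indicators of intervals this is Fubini's theorem.\<close>

lemma L2_fourier_adjoint: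
  assumes "ft.graph_closure h F" "fti.graph_closure S k"
  shows "L2_inner lborel F S = L2_inner lborel h k"
proof -
  have "L2_inner lborel (ivl_fourier I) (ivl_ind J) = 1 * L2_inner lborel (ivl_ind I) (ivl_fourier_inv J)" for I J
    using fourier_exchange[OF integrable_ivl_ind integrable_ivl_ind, of I J]
    unfolding L2_inner_def by simp
  from graph_closure_inner[OF ft.L2_families_axioms fti.swap_family assms(1) _ this] assms(2)
  show ?thesis by (simp add: fti.graph_closure_swap)
qed

text \<open>
  The extension by continuity agrees with the integral where the latter exists: by the adjoint
  relation both have the same integral over every bounded interval.
\<close>

lemma graph_closure_fourier_integrable:
  assumes sq: "square_integrable lborel h" and int: "integrable lborel h"
  shows "ft.graph_closure h (fourier h)"
proof -
  have [measurable]: "h \<in> borel_measurable borel" using int by auto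
  obtain F where F: "ft.graph_closure h F" using L2_fourier_exists[OF sq] by blast
  have Fsq: "square_integrable lborel F" using F by (rule ft.graph_closure_sq)
  then have [measurable]: "F \<in> borel_measurable borel" by (simp add: square_integrable_def)
  \<comment> \<open>The window is needed because \<open>fourier h\<close> is only known to be bounded.\<close>
  have zero: "AE u in lborel. indicator {- real n<..real n} u * (F u - fourier h u) = 0" for n :: nat
  proof (rule L2_orthogonal_to_intervals)
    let ?J = "{- real n<..real n}"
    have "square_integrable lborel (\<lambda>u. indicator ?J u * F u)"
      by (rule square_integrable_bound[OF Fsq, where C=1]) (auto split: split_indicator)
    moreover have "square_integrable lborel (\<lambda>u. indicator ?J u * fourier h u)"
      by (rule square_integrable_bound[OF square_integrable_ivl_ind[of "(- real n, real n)"],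
            where C="LBINT t. cmod (h t)"])
         (use cmod_fourier_le[of h] in \<open>auto simp: ivl_ind_def split: split_indicator\<close>)
    ultimately show "square_integrable lborel (\<lambda>u. indicator ?J u * (F u - fourier h u))"
      using square_integrable_diff by (fastforce simp: right_diff_distrib)
    fix p q :: real
    have eq: "indicator ?J u * ivl_ind (p, q) u = ivl_ind (max p (- real n), min q (real n)) u" for u
      by (auto simp: ivl_ind_def split: split_indicator)
    let ?I = "(max p (- real n), min q (real n))"
    have "L2_inner lborel (\<lambda>u. indicator ?J u * (F u - fourier h u)) (ivl_ind (p, q))
        = (CLBINT u. F u * cnj (ivl_ind ?I u) - fourier h u * ivl_ind ?I u)"
      unfolding L2_inner_def eq[symmetric]
      by (intro Bochner_Integration.integral_cong) (auto simp: ivl_ind_def split: split_indicator)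
    also have "\<dots> = L2_inner lborel F (ivl_ind ?I) - (CLBINT u. fourier h u * ivl_ind ?I u)"
      unfolding L2_inner_def
    proof (rule Bochner_Integration.integral_diff)
      show "complex_integrable lborel (\<lambda>u. F u * cnj (ivl_ind ?I u))"
        by (intro integrable_L2_inner Fsq square_integrable_ivl_ind)
      show "complex_integrable lborel (\<lambda>u. fourier h u * ivl_ind ?I u)"
        by (rule Bochner_Integration.integrable_bound[where f="\<lambda>u. (LBINT t. cmod (h t)) * ivl_ind ?I u"])
           (use cmod_fourier_le[of h] integrable_ivl_ind[of ?I] in
             \<open>auto simp: norm_mult intro!: mult_right_mono AE_I2 order_trans[OF _ abs_ge_self]\<close>)
    qed
    also have "\<dots> = 0"
    proof (cases "?I \<in> intervals")
      case True
      have "L2_inner lborel F (ivl_ind ?I) = (CLBINT t. h t * ivl_fourier ?I t)"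
        unfolding L2_fourier_adjoint[OF F fti.graph_closure_base[OF True]] by (simp add: L2_inner_def)
      then show ?thesis by (simp add: fourier_exchange[OF int integrable_ivl_ind])
    next
      case False
      then have "ivl_ind ?I = (\<lambda>_. 0)" by (auto simp: ivl_ind_def fun_eq_iff split: split_indicator)
      then show ?thesis by (simp add: L2_inner_def)
    qed
    finally show "L2_inner lborel (\<lambda>u. indicator ?J u * (F u - fourier h u)) (ivl_ind (p, q)) = 0" .
  qed
  have "AE u in lborel. \<forall>n::nat. indicator {- real n<..real n} u * (F u - fourier h u) = 0"
    unfolding AE_all_countable by (rule allI) (rule zero)
  then have "AE u in lborel. F u = fourier h u"
  proof eventually_elim
    case (elim u)
    obtain n :: nat where "\<bar>u\<bar> < real n" using reals_Archimedean2 by blast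
    then have "u \<in> {- real n<..real n}" by auto
    then show ?case using elim[rule_format, of n] by simp
  qed
  then show ?thesis by (intro ft.graph_closure_cong_AE[OF F]) auto
qed

lemma truncation_tendsto:
  fixes h :: "real \<Rightarrow> complex"
  assumes "square_integrable lborel h"
  shows "((\<lambda>T. L2_normsq lborel (\<lambda>t. h t - indicator {-T..T} t * h t)) \<longlongrightarrow> 0) at_top"
proof (rule tendsto_at_topI_sequentially)
  fix X :: "nat \<Rightarrow> real" assume X: "filterlim X at_top sequentially"
  have [measurable]: "h \<in> borel_measurable borel" using assms by (simp add: square_integrable_def)
  have "L2_tendsto lborel (\<lambda>n t. indicator {-X n..X n} t * h t) h"
  proof (rule L2_dominated_convergence[where w="\<lambda>t. cmod (h t)"])
    show "integrable lborel (\<lambda>t. (cmod (h t))\<^sup>2)" using assms by (simp add: square_integrable_def)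
    show "AE t in lborel. (\<lambda>n. indicator {-X n..X n} t * h t) \<longlonglongrightarrow> h t"
    proof (rule AE_I2)
      fix t
      have "\<forall>\<^sub>F n in sequentially. \<bar>t\<bar> \<le> X n" using X by (simp add: filterlim_at_top)
      then have "\<forall>\<^sub>F n in sequentially. indicator {-X n..X n} t * h t = h t"
        by eventually_elim (auto split: split_indicator)
      then show "(\<lambda>n. indicator {-X n..X n} t * h t) \<longlonglongrightarrow> h t" by (rule tendsto_eventually)
    qed
    show "AE t in lborel. cmod (indicator {-X n..X n} t * h t) \<le> cmod (h t)" for n
      by (intro AE_I2) (auto split: split_indicator)
  qed measurable
  then show "(\<lambda>n. L2_normsq lborel (\<lambda>t. h t - indicator {-X n..X n} t * h t)) \<longlonglongrightarrow> 0"
    by (simp add: L2_tendsto_def)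
qed

lemma graph_closure_truncation:
  assumes "square_integrable lborel h"
  shows "ft.graph_closure (\<lambda>t. indicator {-T..T} t * h t) (\<lambda>u. CLBINT t:{-T..T}. h t * iexp (t * u))"
proof -
  have [measurable]: "h \<in> borel_measurable borel" using assms by (simp add: square_integrable_def)
  let ?h = "\<lambda>t. indicator {-T..T} t * h t"
  have ind: "square_integrable lborel (indicator {-T..T} :: real \<Rightarrow> complex)"
  proof (rule square_integrable_indicator)
    show "emeasure lborel {-T..T} < \<infinity>" by (cases "-T \<le> T") auto
  qed simp
  have "square_integrable lborel ?h"
    by (rule square_integrable_bound[OF assms, where C=1]) (auto split: split_indicator)
  moreover have "integrable lborel ?h"
    using integrable_L2_inner[OF assms ind]
    by (rule Bochner_Integration.integrable_bound) (auto split: split_indicator)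
  ultimately have "ft.graph_closure ?h (fourier ?h)" by (rule graph_closure_fourier_integrable)
  moreover have "fourier ?h = (\<lambda>u. CLBINT t:{-T..T}. h t * iexp (t * u))"
    unfolding fourier_def set_lebesgue_integral_def
    by (intro ext Bochner_Integration.integral_cong) (auto split: split_indicator)
  ultimately show ?thesis by simp
qed

lemma graph_closure_normsq:
  assumes "ft.graph_closure h F"
  shows "L2_normsq lborel F = ennreal (2 * pi) * L2_normsq lborel h"
  using ft.graph_closure_sq[OF assms] L2_fourier_parseval[OF assms assms]
  by (simp add: L2_normsq_eq_inner L2_inner_self ennreal_mult)

text \<open>
  Truncations are integrable, so they are transformed as the definition of the limit in the mean
  requires; one direction is closedness of the graph, the other is Parseval's identity for the
  remainder.
\<close>

lemma is_L2_fourier_iff: "is_L2_fourier h F \<longleftrightarrow> ft.graph_closure h F"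
proof
  let ?h = "\<lambda>T t. indicator {-T..T} t * h t" and ?F = "\<lambda>T u. CLBINT t:{-T..T}. h t * iexp (t * u)"
  assume "is_L2_fourier h F"
  then have h: "square_integrable lborel h" and F: "square_integrable lborel F"
    and lim: "((\<lambda>T. L2_normsq lborel (\<lambda>u. F u - ?F T u)) \<longlongrightarrow> 0) at_top"
    by (auto simp: is_L2_fourier_def)
  show "ft.graph_closure h F"
  proof (rule ft.graph_closure_closed[OF h F])
    fix \<epsilon> :: ennreal assume "0 < \<epsilon>"
    then have "\<forall>\<^sub>F T in at_top. L2_normsq lborel (\<lambda>t. h t - ?h T t) < \<epsilon> \<and>
        L2_normsq lborel (\<lambda>u. F u - ?F T u) < \<epsilon>"
      by (intro eventually_conj order_tendstoD(2)[OF truncation_tendsto[OF h]] order_tendstoD(2)[OF lim])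
    then obtain T where "L2_normsq lborel (\<lambda>t. h t - ?h T t) < \<epsilon> \<and>
        L2_normsq lborel (\<lambda>u. F u - ?F T u) < \<epsilon>"
      using eventually_happens'[OF trivial_limit_at_top_linorder] by fast
    then show "\<exists>h' F'. ft.graph_closure h' F' \<and> L2_normsq lborel (\<lambda>t. h t - h' t) < \<epsilon> \<and>
        L2_normsq lborel (\<lambda>u. F u - F' u) < \<epsilon>"
      using graph_closure_truncation[OF h, of T] by blast
  qed
next
  let ?h = "\<lambda>T t. indicator {-T..T} t * h t" and ?F = "\<lambda>T u. CLBINT t:{-T..T}. h t * iexp (t * u)"
  assume gc: "ft.graph_closure h F"
  note h = ft.graph_closure_sq(1)[OF gc]
  have "L2_normsq lborel (\<lambda>u. F u - ?F T u) = ennreal (2 * pi) * L2_normsq lborel (\<lambda>t. h t - ?h T t)" for T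
    by (rule graph_closure_normsq) (intro ft.graph_closure_diff gc graph_closure_truncation h)
  moreover have "((\<lambda>T. ennreal (2 * pi) * L2_normsq lborel (\<lambda>t. h t - ?h T t)) \<longlongrightarrow> ennreal (2 * pi) * 0) at_top"
    by (intro ennreal_tendsto_cmult truncation_tendsto h) simp
  ultimately show "is_L2_fourier h F"
    unfolding is_L2_fourier_def using ft.graph_closure_sq[OF gc] by simp
qed

text \<open>
  The transform and its adjoint are both \<open>sqrt (2\<pi>)\<close> times an isometry; an isometry
  whose adjoint is an isometry is onto.
\<close>

lemma L2_fourier_surjective:
  assumes S: "square_integrable lborel S"
  shows "\<exists>h. ft.graph_closure h S"
proof -
  obtain k where k: "fti.graph_closure S k" using L2_fourier_exists[OF S] by blast
  note ksq = fti.graph_closure_sq(2)[OF k]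
  define h where "h = (\<lambda>x. of_real (1 / (2 * pi)) * k x)"
  have hsq: "square_integrable lborel h" unfolding h_def by (intro square_integrable_cmult ksq)
  obtain G where G: "ft.graph_closure h G" using L2_fourier_exists[OF hsq] by blast
  note Gsq = ft.graph_closure_sq(2)[OF G]
  have kk: "L2_inner lborel k k = of_real (2 * pi) * L2_inner lborel S S"
    by (rule graph_closure_inner[OF fti.L2_families_axioms fti.L2_families_axioms k k
          fourier_inv_intervals_parseval])
  have GS: "L2_inner lborel G S = L2_inner lborel S S"
    unfolding L2_fourier_adjoint[OF G k] h_def L2_inner_cmult_left kk by simp
  have GG: "L2_inner lborel G G = L2_inner lborel S S"
    unfolding L2_fourier_parseval[OF G G] h_def L2_inner_cmult_left L2_inner_cmult_right kk by simp
  have SG: "L2_inner lborel S G = L2_inner lborel S S"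
    using cnj_L2_inner[of lborel G S] cnj_L2_inner[of lborel S S] GS by simp
  have "L2_inner lborel (\<lambda>x. G x - S x) (\<lambda>x. G x - S x) = 0"
    using Gsq S by (simp add: L2_inner_diff_left L2_inner_diff_right square_integrable_diff GS GG SG)
  then have "AE x in lborel. G x - S x = 0"
    by (intro L2_inner_self_eq_0_AE square_integrable_diff Gsq S)
  then have "ft.graph_closure h S"
    using G hsq S by (intro ft.graph_closure_cong_AE[OF G]) (auto simp: square_integrable_def)
  then show ?thesis by blast
qed

section \<open>The two Hardy spaces are orthogonal complements\<close>

text \<open>The two preimages live on half-lines that meet in a null set.\<close>

lemma L2_pos_orthogonal_L2_nonpos:
  assumes "F \<in> L2_pos" "G \<in> L2_nonpos"
  shows "L2_inner lborel F G = 0"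
proof -
  obtain h k where h: "AE t in lborel. t \<notin> {0..} \<longrightarrow> h t = 0" "ft.graph_closure h F"
    and k: "AE t in lborel. t \<notin> {..0} \<longrightarrow> k t = 0" "ft.graph_closure k G"
    using assms unfolding L2_fourier_supported_def is_L2_fourier_iff by blast
  have "L2_inner lborel h k = (CLBINT t::real. 0)"
    unfolding L2_inner_def
  proof (rule integral_cong_AE)
    show "AE t in lborel. h t * cnj (k t) = 0"
      using h(1) k(1) AE_lborel_singleton[of 0] by eventually_elim auto
    show "(\<lambda>t. h t * cnj (k t)) \<in> borel_measurable lborel"
      using integrable_L2_inner[OF ft.graph_closure_sq(1)[OF h(2)] ft.graph_closure_sq(1)[OF k(2)]] by simp
  qed simp
  then show ?thesis unfolding L2_fourier_parseval[OF h(2) k(2)] by simp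
qed

text \<open>
  By surjectivity \<open>R\<close> is the transform of some \<open>h\<close>. Testing \<open>R\<close> against the transforms of
  indicators of intervals in the positive half-line shows that \<open>h\<close> vanishes there.
\<close>

lemma orthogonal_L2_pos_imp_L2_nonpos:
  assumes R: "square_integrable lborel R" and orth: "\<And>F. F \<in> L2_pos \<Longrightarrow> L2_inner lborel R F = 0"
  shows "R \<in> L2_nonpos"
proof -
  obtain h where h: "ft.graph_closure h R" using L2_fourier_surjective[OF R] by blast
  note hsq = ft.graph_closure_sq(1)[OF h]
  have [measurable]: "h \<in> borel_measurable borel" using hsq by (simp add: square_integrable_def)
  have "AE t in lborel. indicator {0<..} t * h t = 0"
  proof (rule L2_orthogonal_to_intervals)
    show "square_integrable lborel (\<lambda>t. indicator {0<..} t * h t)"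
      by (rule square_integrable_bound[OF hsq, where C=1]) (auto split: split_indicator)
    fix p q :: real
    let ?I = "(max p 0, q)"
    have "L2_inner lborel (\<lambda>t. indicator {0<..} t * h t) (ivl_ind (p, q)) = L2_inner lborel h (ivl_ind ?I)"
      unfolding L2_inner_def
      by (intro Bochner_Integration.integral_cong) (auto simp: ivl_ind_def split: split_indicator)
    also have "\<dots> = 0"
    proof (cases "?I \<in> intervals")
      case True
      have "ivl_fourier ?I \<in> L2_pos"
        unfolding L2_fourier_supported_def is_L2_fourier_iff
        using ft.graph_closure_base[OF True]
        by (auto simp: ivl_ind_def intro!: exI[of _ "ivl_ind ?I"] AE_I2)
      then have "L2_inner lborel R (ivl_fourier ?I) = 0" by (rule orth)
      then show ?thesis
        using L2_fourier_parseval[OF h ft.graph_closure_base[OF True]] by simp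
    next
      case False
      then have "ivl_ind ?I = (\<lambda>_. 0)" by (auto simp: ivl_ind_def fun_eq_iff split: split_indicator)
      then show ?thesis by (simp add: L2_inner_def)
    qed
    finally show "L2_inner lborel (\<lambda>t. indicator {0<..} t * h t) (ivl_ind (p, q)) = 0" .
  qed
  then have "AE t in lborel. t \<notin> {..0} \<longrightarrow> h t = 0"
    by eventually_elim auto
  then show ?thesis
    unfolding L2_fourier_supported_def is_L2_fourier_iff using h by blast
qed

section \<open>Integrals with respect to the random measure\<close>

lemma random_measure_families:
  assumes "finite_borel_measure \<mu>" "uncorrelated_random_measure P \<mu> W"
  shows "L2_families \<mu> P indicator W (sets borel)"
proof
  interpret finite_borel_measure \<mu> by fact
  show "square_integrable \<mu> (indicator A)" if "A \<in> sets borel" for A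
    using that by (intro square_integrable_indicator) (auto simp: M_is_borel less_top[symmetric])
  show "square_integrable P (W A)" if "A \<in> sets borel" for A
    using assms(2) that by (simp add: uncorrelated_random_measure_def)
qed

text \<open>
  Indexing by the sets themselves instead of by \<open>k < n\<close> makes the integral an instance of the
  graph construction, so that linearity and continuity need no separate proof.
\<close>

lemma has_random_measure_integral_iff:
  assumes "finite_borel_measure \<mu>" "uncorrelated_random_measure P \<mu> W"
  shows "has_random_measure_integral P \<mu> W \<phi> X \<longleftrightarrow>
    L2_families.graph_closure \<mu> P indicator W (sets borel) \<phi> X"
proof -
  interpret A: L2_families \<mu> P indicator W "sets borel" by (rule random_measure_families[OF assms])
  show ?thesis
  proof
    assume *: "has_random_measure_integral P \<mu> W \<phi> X"
    show "A.graph_closure \<phi> X"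
    proof (rule A.graph_closure_closed)
      fix \<epsilon> :: ennreal assume "0 < \<epsilon>"
      then obtain n c B where B: "\<forall>k<n::nat. B k \<in> sets borel"
        and close: "L2_normsq \<mu> (\<lambda>u. \<phi> u - (\<Sum>k<n. c k * indicator (B k) u)) < \<epsilon>"
        "L2_normsq P (\<lambda>\<omega>. X \<omega> - (\<Sum>k<n. c k * W (B k) \<omega>)) < \<epsilon>"
        using * unfolding has_random_measure_integral_def by meson
      have "A.graph_closure (\<lambda>u. \<Sum>k<n. c k * indicator (B k) u) (\<lambda>\<omega>. \<Sum>k<n. c k * W (B k) \<omega>)"
        by (rule A.graph_closure_sum) (use B A.graph_closure_base in auto)
      then show "\<exists>f' g'. A.graph_closure f' g' \<and>
        L2_normsq \<mu> (\<lambda>x. \<phi> x - f' x) < \<epsilon> \<and> L2_normsq P (\<lambda>y. X y - g' y) < \<epsilon>"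
        using close by blast
    qed (use * in \<open>auto simp: has_random_measure_integral_def\<close>)
  next
    assume *: "A.graph_closure \<phi> X"
    show "has_random_measure_integral P \<mu> W \<phi> X"
      unfolding has_random_measure_integral_def
    proof (intro conjI A.graph_closure_sq[OF *] allI impI)
      fix \<epsilon> :: ennreal assume "0 < \<epsilon>"
      then obtain J c where J: "finite J" "J \<subseteq> sets borel"
        "L2_normsq \<mu> (\<lambda>u. \<phi> u - (\<Sum>B\<in>J. c B * indicator B u)) < \<epsilon>"
        "L2_normsq P (\<lambda>\<omega>. X \<omega> - (\<Sum>B\<in>J. c B * W B \<omega>)) < \<epsilon>"
        using * unfolding A.graph_closure_def by meson
      obtain h where h: "bij_betw h {..<card J} J"
        using ex_bij_betw_nat_finite[OF J(1)] by (auto simp: lessThan_atLeast0)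
      have eq: "(\<Sum>B\<in>J. z B) = (\<Sum>k<card J. z (h k))" for z :: "real set \<Rightarrow> complex"
        by (rule sum.reindex_bij_betw[OF h, symmetric])
      have "\<forall>k<card J. h k \<in> sets borel" using h J(2) by (auto simp: bij_betw_def)
      then show "\<exists>(n::nat) c A. (\<forall>k<n. A k \<in> sets borel) \<and>
          L2_normsq \<mu> (\<lambda>u. \<phi> u - (\<Sum>k<n. c k * indicator (A k) u)) < \<epsilon> \<and>
          L2_normsq P (\<lambda>\<omega>. X \<omega> - (\<Sum>k<n. c k * W (A k) \<omega>)) < \<epsilon>"
        using J(3,4) unfolding eq
        by (intro exI[of _ "card J"] exI[of _ "\<lambda>k. c (h k)"] exI[of _ h]) auto
    qed
  qed
qed

section \<open>The span of the exponentials with nonpositive frequencies\<close>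

abbreviation (input) expo :: "real \<Rightarrow> real \<Rightarrow> complex" where
  "expo \<tau> \<equiv> (\<lambda>u. iexp (\<tau> * u))"

lemma image_Collect_le: "{F \<tau> | \<tau>. \<tau> \<le> (t::real)} = F ` {..t}"
  by auto

lemma closed_span_mono:
  assumes "A \<subseteq> B"
  shows "closed_span M A \<subseteq> closed_span M B"
proof
  fix f assume f: "f \<in> closed_span M A"
  have "\<exists>F c. finite F \<and> F \<subseteq> B \<and> L2_normsq M (\<lambda>x. f x - (\<Sum>a\<in>F. c a * a x)) < \<epsilon>"
    if "0 < \<epsilon>" for \<epsilon>
  proof -
    have "\<exists>F c. finite F \<and> F \<subseteq> A \<and> L2_normsq M (\<lambda>x. f x - (\<Sum>a\<in>F. c a * a x)) < \<epsilon>"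
      using f that by (simp add: closed_span_def)
    then show ?thesis using assms by (elim ex_forward conj_forward) auto
  qed
  then show "f \<in> closed_span M B" using f by (simp add: closed_span_def)
qed

context finite_borel_measure
begin

lemma borel_measurable_M: "borel_measurable M = borel_measurable borel"
  by (rule measurable_cong_sets) (auto simp: M_is_borel)

lemma square_integrable_expo: "square_integrable M (expo \<tau>)"
  unfolding square_integrable_def borel_measurable_M by simp

lemma expo_families: "L2_families M M expo expo I"
  by unfold_locales (rule square_integrable_expo)+

lemma closed_span_expo_shift:
  assumes "g \<in> closed_span M (expo ` {..s})"
  shows "(\<lambda>u. expo t u * g u) \<in> closed_span M (expo ` {..s + t})"
proof -
  have "(\<lambda>u. expo t u * g u) \<in> closed_span M ((\<lambda>\<tau> u. expo t u * expo \<tau> u) ` {..s})"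
    by (rule closed_span_mult[OF assms square_integrable_expo])
       (auto simp: borel_measurable_M L2_normsq_def norm_mult)
  moreover have "(\<lambda>\<tau> u. expo t u * expo \<tau> u) ` {..s} \<subseteq> expo ` {..s + t}"
  proof (rule image_subsetI)
    fix \<tau> assume "\<tau> \<in> {..s}"
    then have "\<tau> + t \<in> {..s + t}" by simp
    moreover have "(\<lambda>u. expo t u * expo \<tau> u) = expo (\<tau> + t)"
      by (auto simp: fun_eq_iff exp_add[symmetric] ring_distribs add.commute)
    ultimately show "(\<lambda>u. expo t u * expo \<tau> u) \<in> expo ` {..s + t}" by (simp only: image_eqI)
  qed
  ultimately show ?thesis by (rule subsetD[OF closed_span_mono, rotated])
qed

text \<open>
  The space is stable under multiplication by exponentials of its own frequencies, hence by
  bounded pointwise limits of their linear combinations.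
\<close>

lemma G_nonpos_mult_limit:
  assumes g: "g \<in> G_nonpos M"
    and S: "\<And>n u. S n u = (\<Sum>k\<in>K n. c n k * expo (t n k) u)" "\<And>n. finite (K n)"
      "\<And>n k. k \<in> K n \<Longrightarrow> t n k \<le> (0::real)"
    and bound: "\<And>n u. cmod (S n u) \<le> C"
    and lim: "\<And>u. (\<lambda>n. S n u) \<longlonglongrightarrow> w u"
  shows "(\<lambda>u. w u * g u) \<in> G_nonpos M"
proof -
  interpret E: L2_families M M expo expo "{..0}" by (rule expo_families)
  have G: "h \<in> G_nonpos M \<longleftrightarrow> E.graph_closure h h" for h
    unfolding G_nonpos_def image_Collect_le
    by (rule closed_span_eq_graph_closure) (rule square_integrable_expo)
  have gm [measurable]: "g \<in> borel_measurable M"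
    using g by (auto simp: G_nonpos_def closed_span_def square_integrable_def)
  have [measurable]: "S n \<in> borel_measurable M" for n
    unfolding S(1)[abs_def] borel_measurable_M by measurable
  have [measurable]: "w \<in> borel_measurable M"
    by (rule borel_measurable_LIMSEQ_metric[OF _ lim]) measurable
  have gc: "E.graph_closure (\<lambda>u. S n u * g u) (\<lambda>u. S n u * g u)" for n
  proof -
    have "E.graph_closure (\<lambda>u. expo (t n k) u * g u) (\<lambda>u. expo (t n k) u * g u)" if "k \<in> K n" for k
    proof -
      have "(\<lambda>u. expo (t n k) u * g u) \<in> closed_span M (expo ` {..0 + t n k})"
        using g unfolding G_nonpos_def image_Collect_le by (rule closed_span_expo_shift)
      then have "(\<lambda>u. expo (t n k) u * g u) \<in> closed_span M (expo ` {..0})"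
        by (rule subsetD[OF closed_span_mono, rotated]) (use S(3)[OF that] in auto)
      then show ?thesis unfolding G[symmetric] G_nonpos_def image_Collect_le .
    qed
    from E.graph_closure_sum[OF S(2)[of n] this, where c="c n"] show ?thesis
      by (simp only: S(1) sum_distrib_right mult.assoc)
  qed
  have L2lim: "L2_tendsto M (\<lambda>n u. S n u * g u) (\<lambda>u. w u * g u)"
  proof (rule L2_dominated_convergence[where w="\<lambda>u. C * cmod (g u)"])
    show "integrable M (\<lambda>u. (C * cmod (g u))\<^sup>2)"
      using g by (simp add: G_nonpos_def closed_span_def square_integrable_def power_mult_distrib)
    show "AE u in M. (\<lambda>n. S n u * g u) \<longlonglongrightarrow> w u * g u"
      by (intro AE_I2 tendsto_intros lim)
    show "AE u in M. cmod (S n u * g u) \<le> C * cmod (g u)" for n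
      using bound by (intro AE_I2) (auto simp: norm_mult intro: mult_right_mono)
  qed measurable
  show ?thesis unfolding G by (rule E.graph_closure_tendsto[OF gc L2lim L2lim])
qed

end

section \<open>Transforms of causal complex measures\<close>

text \<open>The cells with index in \<open>grid n\<close> partition \<open>[-(n+1), n+1)\<close> with mesh \<open>1/(n+1)\<close>.\<close>

abbreviation grid_cell :: "nat \<Rightarrow> int \<Rightarrow> real set" where
  "grid_cell n k \<equiv> {k / Suc n ..< (k + 1) / Suc n}"

abbreviation grid :: "nat \<Rightarrow> int set" where
  "grid n \<equiv> {- (int (Suc n))\<^sup>2 ..< (int (Suc n))\<^sup>2}"

lemma grid_cell_iff: "\<tau> \<in> grid_cell n k \<longleftrightarrow> k = \<lfloor>real (Suc n) * \<tau>\<rfloor>"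
proof -
  have "\<tau> \<in> grid_cell n k \<longleftrightarrow> of_int k \<le> real (Suc n) * \<tau> \<and> real (Suc n) * \<tau> < of_int k + 1"
    by (simp add: field_simps)
  also have "\<dots> \<longleftrightarrow> \<lfloor>real (Suc n) * \<tau>\<rfloor> = k" by (simp only: floor_eq_iff)
  finally show ?thesis by (simp only: eq_commute[of k])
qed

text \<open>
  The sum is the integral of the exponential at the left end point of the cell of \<open>\<tau>\<close>, which tends
  to \<open>\<tau>\<close>; the integrands are bounded by 1.
\<close>

lemma riemann_sums_tendsto:
  assumes "finite_borel_measure p"
  shows "(\<lambda>n. \<Sum>k\<in>grid n. iexp (- (k / Suc n * u)) * of_real (measure p (grid_cell n k)))
    \<longlonglongrightarrow> (CLINT \<tau>|p. iexp (- (\<tau> * u)))"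
proof -
  interpret finite_borel_measure p by fact
  let ?s = "\<lambda>n \<tau>. \<Sum>k\<in>grid n. iexp (- (k / Suc n * u)) * indicator (grid_cell n k) \<tau>"
  have s: "?s n \<tau> = (if \<lfloor>real (Suc n) * \<tau>\<rfloor> \<in> grid n then iexp (- (\<lfloor>real (Suc n) * \<tau>\<rfloor> / Suc n * u)) else 0)" for n \<tau>
  proof -
    have "?s n \<tau> = (\<Sum>k\<in>grid n. if k = \<lfloor>real (Suc n) * \<tau>\<rfloor> then iexp (- (k / Suc n * u)) else 0)"
      by (intro sum.cong refl) (simp only: indicator_def grid_cell_iff, simp)
    then show ?thesis by simp
  qed
  have int: "(CLINT \<tau>|p. ?s n \<tau>) = (\<Sum>k\<in>grid n. iexp (- (k / Suc n * u)) * of_real (measure p (grid_cell n k)))" for n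
  proof -
    have "integrable p (\<lambda>\<tau>. complex_of_real (indicator (grid_cell n k) \<tau>))" for k
      by (intro integrable_of_real integrable_real_indicator) (auto simp: M_is_borel less_top[symmetric])
    then have "(CLINT \<tau>|p. \<Sum>k\<in>grid n. iexp (- (k / Suc n * u)) * complex_of_real (indicator (grid_cell n k) \<tau>))
        = (\<Sum>k\<in>grid n. CLINT \<tau>|p. iexp (- (k / Suc n * u)) * complex_of_real (indicator (grid_cell n k) \<tau>))"
      by (intro Bochner_Integration.integral_sum integrable_mult_right)
    moreover have "(CLINT \<tau>|p. complex_of_real (indicator (grid_cell n k) \<tau>)) = of_real (measure p (grid_cell n k))" for k
      by (simp only: integral_complex_of_real) (simp add: M_is_borel)
    ultimately show ?thesis by (simp only: of_real_indicator integral_mult_right_zero)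
  qed
  have "(\<lambda>n. CLINT \<tau>|p. ?s n \<tau>) \<longlonglongrightarrow> (CLINT \<tau>|p. iexp (- (\<tau> * u)))"
  proof (rule integral_dominated_convergence[where w="\<lambda>_. 1"])
    show "(\<lambda>\<tau>. iexp (- (\<tau> * u))) \<in> borel_measurable p" unfolding borel_measurable_M by measurable
    show "?s n \<in> borel_measurable p" for n unfolding borel_measurable_M by measurable
    show "AE \<tau> in p. norm (?s n \<tau>) \<le> 1" for n
      by (intro AE_I2) (simp only: s, simp add: norm_exp_eq_Re)
    show "AE \<tau> in p. (\<lambda>n. ?s n \<tau>) \<longlonglongrightarrow> iexp (- (\<tau> * u))"
    proof (rule AE_I2)
      fix \<tau> :: real
      have "(\<lambda>n. \<lfloor>real (Suc n) * \<tau>\<rfloor> / real (Suc n)) \<longlonglongrightarrow> \<tau>"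
      proof (rule tendsto_sandwich)
        show "(\<lambda>n. \<tau> - 1 / real (Suc n)) \<longlonglongrightarrow> \<tau>"
          using tendsto_diff[OF tendsto_const[of \<tau>] LIMSEQ_Suc[OF lim_1_over_n]] by simp
        show "\<forall>\<^sub>F n in sequentially. \<tau> - 1 / real (Suc n) \<le> \<lfloor>real (Suc n) * \<tau>\<rfloor> / real (Suc n)"
        proof (rule always_eventually, rule allI)
          fix n
          have "real (Suc n) * \<tau> - 1 \<le> \<lfloor>real (Suc n) * \<tau>\<rfloor>" by linarith
          then have "(real (Suc n) * \<tau> - 1) / real (Suc n) \<le> \<lfloor>real (Suc n) * \<tau>\<rfloor> / real (Suc n)"
            by (rule divide_right_mono) simp
          moreover have "(real (Suc n) * \<tau> - 1) / real (Suc n) = \<tau> - 1 / real (Suc n)"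
            by (simp add: diff_divide_distrib)
          ultimately show "\<tau> - 1 / real (Suc n) \<le> \<lfloor>real (Suc n) * \<tau>\<rfloor> / real (Suc n)" by simp
        qed
        show "\<forall>\<^sub>F n in sequentially. \<lfloor>real (Suc n) * \<tau>\<rfloor> / real (Suc n) \<le> \<tau>"
        proof (rule always_eventually, rule allI)
          fix n
          have "\<lfloor>real (Suc n) * \<tau>\<rfloor> / real (Suc n) \<le> (real (Suc n) * \<tau>) / real (Suc n)"
            by (rule divide_right_mono) auto
          then show "\<lfloor>real (Suc n) * \<tau>\<rfloor> / real (Suc n) \<le> \<tau>" by simp
        qed
      qed simp
      then have lim: "(\<lambda>n. iexp (- (\<lfloor>real (Suc n) * \<tau>\<rfloor> / real (Suc n) * u))) \<longlonglongrightarrow> iexp (- (\<tau> * u))"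
        by (intro tendsto_intros)
      obtain m :: nat where m: "\<bar>\<tau>\<bar> < real m" using reals_Archimedean2 by blast
      have "\<forall>\<^sub>F n in sequentially. iexp (- (\<lfloor>real (Suc n) * \<tau>\<rfloor> / real (Suc n) * u)) = ?s n \<tau>"
      proof (rule eventually_sequentiallyI[of m])
        fix n assume "m \<le> n"
        then have t: "- real (Suc n) < \<tau>" "\<tau> < real (Suc n)" using m by auto
        have "real (Suc n) * (- real (Suc n)) \<le> real (Suc n) * \<tau>"
          "real (Suc n) * \<tau> < real (Suc n) * real (Suc n)"
          using t by (intro mult_left_mono mult_strict_left_mono; simp)+
        then have "\<lfloor>real (Suc n) * \<tau>\<rfloor> \<in> grid n"
          by (simp add: le_floor_iff floor_less_iff power2_eq_square del: of_nat_Suc)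
        then show "iexp (- (\<lfloor>real (Suc n) * \<tau>\<rfloor> / real (Suc n) * u)) = ?s n \<tau>"
          unfolding s by (simp only: if_True)
      qed
      from Lim_transform_eventually[OF lim this] show "(\<lambda>n. ?s n \<tau>) \<longlonglongrightarrow> iexp (- (\<tau> * u))" .
    qed
  qed simp
  then show ?thesis unfolding int .
qed

lemma grid_measure_sum_le:
  assumes "finite_borel_measure p"
  shows "(\<Sum>k\<in>grid n. measure p (grid_cell n k)) \<le> measure p (space p)"
proof -
  interpret finite_borel_measure p by fact
  have "disjoint_family_on (grid_cell n) (grid n)"
    unfolding disjoint_family_on_def
    by (intro ballI impI equals0I) (metis IntE grid_cell_iff)
  then have "(\<Sum>k\<in>grid n. measure p (grid_cell n k)) = measure p (\<Union>k\<in>grid n. grid_cell n k)"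
    by (intro finite_measure_finite_Union[symmetric]) (auto simp: M_is_borel)
  also have "\<dots> \<le> measure p (space p)" by (rule bounded_measure)
  finally show ?thesis .
qed

text \<open>
  The Riemann sums only involve \<open>\<nu>\<close> itself, so they do not depend on the decomposition of
  \<open>\<nu>\<close> into positive measures, which may change with \<open>u\<close>; the decomposition for one fixed
  \<open>u\<close> bounds them uniformly.
\<close>

lemma causal_transform_approx:
  assumes "inverse_is_causal_transform lam"
  obtains S :: "nat \<Rightarrow> real \<Rightarrow> complex" and K :: "nat \<Rightarrow> int set" and c t C where
    "\<And>n u. S n u = (\<Sum>k\<in>K n. c n k * expo (t n k) u)" "\<And>n. finite (K n)"
    "\<And>n k. k \<in> K n \<Longrightarrow> t n k \<le> 0"
    "\<And>n u. cmod (S n u) \<le> C" "\<And>u. (\<lambda>n. S n u) \<longlonglongrightarrow> 1 / lam u"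
proof -
  obtain \<nu> where conc: "concentrated_on \<nu> {0..}"
    and \<nu>: "\<And>u. has_complex_measure_integral \<nu> (\<lambda>\<tau>. iexp (- (\<tau> * u))) (1 / lam u)"
    using assms unfolding inverse_is_causal_transform_def by blast
  define S where "S n u = (\<Sum>k\<in>grid n. iexp (- (k / Suc n * u)) * \<nu> (grid_cell n k))" for n u
  obtain p p' q q' where fin: "finite_borel_measure p" "finite_borel_measure p'"
      "finite_borel_measure q" "finite_borel_measure q'"
    and dec: "\<And>A. A \<in> sets borel \<Longrightarrow> \<nu> A = Complex (measure p A - measure p' A) (measure q A - measure q' A)"
    using \<nu>[of 0] unfolding has_complex_measure_integral_def by auto
  let ?C = "measure p (space p) + measure p' (space p') + (measure q (space q) + measure q' (space q'))"
  have bound: "cmod (S n u) \<le> ?C" for n u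
  proof -
    have "cmod (S n u) \<le> (\<Sum>k\<in>grid n. cmod (\<nu> (grid_cell n k)))"
      unfolding S_def by (rule order_trans[OF norm_sum]) (simp add: norm_mult)
    also have "\<dots> \<le> (\<Sum>k\<in>grid n. (measure p (grid_cell n k) + measure p' (grid_cell n k))
        + (measure q (grid_cell n k) + measure q' (grid_cell n k)))"
    proof (rule sum_mono)
      fix k
      have "cmod (\<nu> (grid_cell n k)) \<le> \<bar>measure p (grid_cell n k) - measure p' (grid_cell n k)\<bar>
        + \<bar>measure q (grid_cell n k) - measure q' (grid_cell n k)\<bar>"
        using cmod_le[of "\<nu> (grid_cell n k)"] by (simp add: dec)
      also have "\<dots> \<le> (measure p (grid_cell n k) + measure p' (grid_cell n k))
        + (measure q (grid_cell n k) + measure q' (grid_cell n k))"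
        using measure_nonneg[of p "grid_cell n k"] measure_nonneg[of p' "grid_cell n k"]
          measure_nonneg[of q "grid_cell n k"] measure_nonneg[of q' "grid_cell n k"] by linarith
      finally show "cmod (\<nu> (grid_cell n k)) \<le> (measure p (grid_cell n k) + measure p' (grid_cell n k))
        + (measure q (grid_cell n k) + measure q' (grid_cell n k))" .
    qed
    also have "\<dots> \<le> ?C"
      unfolding sum.distrib using fin by (intro add_mono grid_measure_sum_le)
    finally show ?thesis .
  qed
  have lim: "(\<lambda>n. S n u) \<longlonglongrightarrow> 1 / lam u" for u
  proof -
    obtain p p' q q' where fin: "finite_borel_measure p" "finite_borel_measure p'"
        "finite_borel_measure q" "finite_borel_measure q'"
      and dec: "\<And>A. A \<in> sets borel \<Longrightarrow> \<nu> A = Complex (measure p A - measure p' A) (measure q A - measure q' A)"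
      and I: "1 / lam u = ((CLINT \<tau>|p. iexp (- (\<tau> * u))) - (CLINT \<tau>|p'. iexp (- (\<tau> * u))))
        + \<i> * ((CLINT \<tau>|q. iexp (- (\<tau> * u))) - (CLINT \<tau>|q'. iexp (- (\<tau> * u))))"
      using \<nu>[of u] unfolding has_complex_measure_integral_def by auto
    let ?r = "\<lambda>p n. \<Sum>k\<in>grid n. iexp (- (k / Suc n * u)) * of_real (measure p (grid_cell n k))"
    have "S n u = (?r p n - ?r p' n) + \<i> * (?r q n - ?r q' n)" for n
      unfolding S_def sum_subtractf[symmetric] sum_distrib_left sum.distrib[symmetric]
      by (intro sum.cong refl) (simp add: dec Complex_eq algebra_simps)
    moreover have "(\<lambda>n. (?r p n - ?r p' n) + \<i> * (?r q n - ?r q' n)) \<longlonglongrightarrow> 1 / lam u"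
      unfolding I by (intro tendsto_intros riemann_sums_tendsto fin)
    ultimately show ?thesis by simp
  qed
  \<comment> \<open>Cells with a negative index lie in the negative half-line, which \<open>\<nu>\<close> does not charge.\<close>
  have causal: "S n u = (\<Sum>k\<in>grid n \<inter> {0..}. \<nu> (grid_cell n k) * expo (- (k / Suc n)) u)" for n u
    unfolding S_def
  proof (rule sum.mono_neutral_cong_right)
    show "\<forall>k\<in>grid n - grid n \<inter> {0..}. iexp (- (k / Suc n * u)) * \<nu> (grid_cell n k) = 0"
    proof
      fix k assume "k \<in> grid n - grid n \<inter> {0..}"
      then have "k + 1 \<le> 0" by auto
      then have "of_int k + (1::real) \<le> 0" by linarith
      then have "(of_int k + 1) / real (Suc n) \<le> 0" by (rule divide_nonpos_nonneg) simp
      then have "grid_cell n k \<inter> {0..} = {}" by auto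
      then have "\<nu> (grid_cell n k) = 0" using conc by (simp add: concentrated_on_def)
      then show "iexp (- (k / Suc n * u)) * \<nu> (grid_cell n k) = 0" by simp
    qed
  qed auto
  show thesis
    by (rule that[OF causal _ _ bound lim]) auto
qed

section \<open>The approximating process\<close>

text \<open>
  The covariance of \<open>B\<close> is the Gram matrix of the exponentials in \<open>L\<^sup>2(\<mu>)\<close>, so the map from
  exponentials to the variables of \<open>B\<close> extends to the closed spans. It maps the frequencies up to
  \<open>t\<close> to the past of \<open>t\<close>, and it agrees with the stochastic integral because it does so on every
  exponential.
\<close>

lemma adaptive_process_exists:
  assumes cs: "centered_stationary P B K" and sm: "is_spectral_measure K \<mu>"
    and um: "uncorrelated_random_measure P \<mu> W"
    and rep: "\<And>t. has_random_measure_integral P \<mu> W (expo t) (B t)"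
    and g: "g \<in> G_nonpos \<mu>"
  shows "\<exists>X. has_random_measure_integral P \<mu> W (\<lambda>u. g u * expo t u) X \<and>
    X \<in> closed_span P {B \<tau> | \<tau>. \<tau> \<le> t}"
proof -
  have fin: "finite_borel_measure \<mu>" using sm by (simp add: is_spectral_measure_def)
  interpret finite_borel_measure \<mu> by fact
  have Bsq: "square_integrable P (B s)" for s
    using cs by (simp add: centered_stationary_def)
  interpret EB: L2_families \<mu> P expo B "{..t}"
    by unfold_locales (rule square_integrable_expo Bsq)+
  interpret IW: L2_families \<mu> P indicator W "sets borel"
    by (rule random_measure_families[OF fin um])
  have gram: "L2_inner P (B r) (B s) = of_real 1 * L2_inner \<mu> (expo r) (expo s)" for r s
  proof -
    have "L2_inner P (B r) (B s) = covariance P (B r) (B s)"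
      using cs by (simp add: centered_stationary_def covariance_def L2_inner_def)
    also have "\<dots> = K (r - s)" using cs by (simp add: centered_stationary_def)
    also have "\<dots> = (CLINT u|\<mu>. iexp ((r - s) * u))" using sm by (simp add: is_spectral_measure_def)
    also have "\<dots> = L2_inner \<mu> (expo r) (expo s)"
      unfolding L2_inner_def
      by (intro Bochner_Integration.integral_cong refl)
         (simp add: exp_cnj exp_add[symmetric] algebra_simps)
    finally show ?thesis by simp
  qed
  have "(\<lambda>u. expo t u * g u) \<in> closed_span \<mu> (expo ` {..0 + t})"
    using g unfolding G_nonpos_def image_Collect_le by (rule closed_span_expo_shift)
  then have gt: "(\<lambda>u. g u * expo t u) \<in> closed_span \<mu> (expo ` {..t})"
    by (simp only: mult.commute[of "g _"] add_0)
  then have "\<exists>X. EB.graph_closure (\<lambda>u. g u * expo t u) X"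
    unfolding closed_span_image_iff
    by (intro EB.graph_closure_extension[where \<kappa>=1, OF gram]) auto
  then obtain X where X: "EB.graph_closure (\<lambda>u. g u * expo t u) X" ..
  have "IW.graph_closure (\<lambda>u. g u * expo t u) X"
    by (rule IW.graph_closure_trans[OF EB.L2_families_axioms _ X])
       (rule rep[unfolded has_random_measure_integral_iff[OF fin um]])
  then have "has_random_measure_integral P \<mu> W (\<lambda>u. g u * expo t u) X"
    by (simp only: has_random_measure_integral_iff[OF fin um])
  moreover have "X \<in> closed_span P {B \<tau> | \<tau>. \<tau> \<le> t}"
    unfolding image_Collect_le using X by (rule EB.graph_closure_imp_closed_span)
  ultimately show ?thesis by blast
qed

section \<open>Reduction to a projection in \<open>L\<^sup>2(\<real>)\<close>\<close>

locale outer_spectral_factor =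
  fixes \<mu> :: "real measure" and f :: "real \<Rightarrow> real" and \<gamma> :: "real \<Rightarrow> complex"
  assumes f_measurable [measurable]: "f \<in> borel_measurable borel"
    and density: "\<mu> = density lborel (\<lambda>u. ennreal (f u))"
    and finite: "finite_borel_measure \<mu>"
    and f_pos: "AE u in lborel. 0 < f u"
    and outer: "outer_lower_half_plane \<gamma>"
    and factor: "AE u in lborel. f u = (cmod (\<gamma> u))\<^sup>2"
begin

sublocale finite_borel_measure \<mu> by (rule finite)

lemma \<gamma>_sq: "square_integrable lborel \<gamma>"
  using outer by (simp add: outer_lower_half_plane_def)

lemma \<gamma>_measurable [measurable]: "\<gamma> \<in> borel_measurable borel"
  using \<gamma>_sq by (simp add: square_integrable_def)

lemma \<gamma>_nonzero: "AE u in lborel. \<gamma> u \<noteq> 0"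
  using f_pos factor by eventually_elim auto

lemma nn_integral_\<mu>:
  assumes [measurable]: "h \<in> borel_measurable borel"
  shows "(\<integral>\<^sup>+u. h u \<partial>\<mu>) = (\<integral>\<^sup>+u. ennreal ((cmod (\<gamma> u))\<^sup>2) * h u \<partial>lborel)"
  unfolding density
  by (subst nn_integral_density)
     (use factor in \<open>auto intro!: nn_integral_cong_AE elim: eventually_mono\<close>)

lemma L2_normsq_\<mu>:
  assumes [measurable]: "h \<in> borel_measurable borel"
  shows "L2_normsq \<mu> h = L2_normsq lborel (\<lambda>u. \<gamma> u * h u)"
  unfolding L2_normsq_def
  by (subst nn_integral_\<mu>) (auto simp: norm_mult power_mult_distrib ennreal_mult)

lemma square_integrable_\<mu>_iff:
  assumes "h \<in> borel_measurable borel"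
  shows "square_integrable \<mu> h \<longleftrightarrow> square_integrable lborel (\<lambda>u. \<gamma> u * h u)"
  using assms by (simp add: square_integrable_iff_normsq_finite borel_measurable_M L2_normsq_\<mu>)

lemma L2_nonpos_eq: "L2_nonpos = closed_span lborel ((\<lambda>\<tau> u. \<gamma> u * expo \<tau> u) ` {..0})"
  using outer by (simp only: outer_lower_half_plane_def image_Collect_le)

lemma \<gamma>_mult_in_L2_nonpos:
  assumes "g \<in> G_nonpos \<mu>"
  shows "(\<lambda>u. \<gamma> u * g u) \<in> L2_nonpos"
  unfolding L2_nonpos_eq using assms unfolding G_nonpos_def image_Collect_le
  by (rule closed_span_mult[OF _ square_integrable_expo])
     (auto simp: borel_measurable_M L2_normsq_\<mu> M_is_borel)

text \<open>
  An approximation of \<open>F\<close> by combinations of \<open>\<gamma> e\<^bsup>i\<tau>u\<^esup>\<close> in \<open>L\<^sup>2(\<real>)\<close> is an approximation of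
  \<open>g = F / \<gamma>\<close> by exponential sums in \<open>L\<^sup>2(\<mu>)\<close>, with the same error.
\<close>

lemma in_G_nonposI:
  assumes [measurable]: "g \<in> borel_measurable borel"
    and F: "F \<in> L2_nonpos" and eq: "AE u in lborel. \<gamma> u * g u = F u"
  shows "g \<in> G_nonpos \<mu>"
  unfolding G_nonpos_def image_Collect_le closed_span_image_iff
proof (intro conjI allI impI)
  have "square_integrable lborel F" using F unfolding L2_nonpos_eq by (rule closed_span_sq)
  then have "square_integrable lborel (\<lambda>u. \<gamma> u * g u)"
    by (rule square_integrable_cong_AE) (use eq in \<open>auto elim: eventually_mono\<close>)
  then show "square_integrable \<mu> g" by (simp add: square_integrable_\<mu>_iff)
  fix \<epsilon> :: ennreal assume "0 < \<epsilon>"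
  then obtain J c where J: "finite J" "J \<subseteq> {..0}"
    "L2_normsq lborel (\<lambda>u. F u - (\<Sum>\<tau>\<in>J. c \<tau> * (\<gamma> u * expo \<tau> u))) < \<epsilon>"
    using F unfolding L2_nonpos_eq closed_span_image_iff by blast
  have "L2_normsq \<mu> (\<lambda>u. g u - (\<Sum>\<tau>\<in>J. c \<tau> * expo \<tau> u))
      = L2_normsq lborel (\<lambda>u. \<gamma> u * (g u - (\<Sum>\<tau>\<in>J. c \<tau> * expo \<tau> u)))"
    by (rule L2_normsq_\<mu>) measurable
  also have "\<dots> = L2_normsq lborel (\<lambda>u. F u - (\<Sum>\<tau>\<in>J. c \<tau> * (\<gamma> u * expo \<tau> u)))"
    using eq
    by (intro L2_normsq_cong_AE) (auto elim!: eventually_mono simp: right_diff_distrib sum_distrib_left mult_ac)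
  finally show "\<exists>J c. finite J \<and> J \<subseteq> {..0} \<and> L2_normsq \<mu> (\<lambda>u. g u - (\<Sum>\<tau>\<in>J. c \<tau> * expo \<tau> u)) < \<epsilon>"
    using J by (intro exI[of _ J] exI[of _ c]) simp
qed

lemma L2_nonpos_diff: "F \<in> L2_nonpos \<Longrightarrow> G \<in> L2_nonpos \<Longrightarrow> (\<lambda>u. F u - G u) \<in> L2_nonpos"
proof -
  have sq: "square_integrable lborel (\<lambda>u. \<gamma> u * expo \<tau> u)" for \<tau>
    by (rule square_integrable_bound[OF \<gamma>_sq, where C=1]) (auto simp: norm_mult)
  interpret A: L2_families lborel lborel "\<lambda>\<tau> u. \<gamma> u * expo \<tau> u" "\<lambda>\<tau> u. \<gamma> u * expo \<tau> u" "{..0}"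
    by unfold_locales (rule sq)+
  show "F \<in> L2_nonpos \<Longrightarrow> G \<in> L2_nonpos \<Longrightarrow> (\<lambda>u. F u - G u) \<in> L2_nonpos"
    unfolding L2_nonpos_eq closed_span_eq_graph_closure[OF sq] by (rule A.graph_closure_diff)
qed

end

section \<open>The optimal adaptive approximation\<close>

locale adaptive_problem = outer_spectral_factor \<mu> f \<gamma>
  for \<mu> :: "real measure" and f :: "real \<Rightarrow> real" and \<gamma> :: "real \<Rightarrow> complex" +
  fixes l :: "complex \<Rightarrow> complex" and lam Q :: "real \<Rightarrow> complex"
  assumes lam: "\<And>u. (cmod (l (\<i> * of_real u)))\<^sup>2 + 1 = (cmod (lam u))\<^sup>2"
    and causal: "inverse_is_causal_transform lam"
    and preserves: "multiplier_preserves_G_nonpos \<mu> lam"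
    and proj: "orthogonal_projection lborel L2_pos (\<lambda>u. \<gamma> u / cnj (lam u)) Q"
begin

abbreviation "target \<equiv> (\<lambda>u. \<gamma> u / cnj (lam u))"

abbreviation "residual \<equiv> (\<lambda>u. target u - Q u)"

definition "g_opt = (\<lambda>u. of_real (1 / (cmod (lam u))\<^sup>2) - Q u / (lam u * \<gamma> u))"

lemma cmod_lam_ge_1: "1 \<le> cmod (lam u)"
proof -
  have "1\<^sup>2 \<le> (cmod (lam u))\<^sup>2"
    unfolding lam[symmetric] by simp
  then show ?thesis by (rule power2_le_imp_le) simp
qed

lemma lam_nonzero: "lam u \<noteq> 0"
  using cmod_lam_ge_1[of u] by auto

lemma lam_div_normsq: "lam u * of_real (1 / (cmod (lam u))\<^sup>2) = 1 / cnj (lam u)"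
  by (simp only: of_real_divide of_real_1 complex_norm_square) (simp add: lam_nonzero)

lemma energy_eq: "(cmod (l (\<i> * of_real u)))\<^sup>2 = (cmod (lam u))\<^sup>2 - 1"
  by (simp add: lam[symmetric])

text \<open>\<open>1 / lam\<close> is a pointwise limit of exponential sums.\<close>

lemma lam_measurable [measurable]: "lam \<in> borel_measurable borel"
proof -
  obtain S :: "nat \<Rightarrow> real \<Rightarrow> complex" and K :: "nat \<Rightarrow> int set" and c t C where
    S: "\<And>n u. S n u = (\<Sum>k\<in>K n. c n k * expo (t n k) u)" and lim: "\<And>u. (\<lambda>n. S n u) \<longlonglongrightarrow> 1 / lam u"
    using causal by (rule causal_transform_approx) blast
  have [measurable]: "S n \<in> borel_measurable borel" for n
    unfolding S[abs_def] by measurable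
  have "(\<lambda>u. 1 / lam u) \<in> borel_measurable borel"
    by (rule borel_measurable_LIMSEQ_metric[OF _ lim]) measurable
  then have "(\<lambda>u. 1 / (1 / lam u)) \<in> borel_measurable borel" by measurable
  then show ?thesis by simp
qed

lemma G_nonpos_divide_lam:
  assumes "g \<in> G_nonpos \<mu>"
  shows "(\<lambda>u. g u / lam u) \<in> G_nonpos \<mu>"
proof -
  obtain S :: "nat \<Rightarrow> real \<Rightarrow> complex" and K :: "nat \<Rightarrow> int set" and c t C where
    S: "\<And>n u. S n u = (\<Sum>k\<in>K n. c n k * expo (t n k) u)" "\<And>n. finite (K n)"
      "\<And>n k. k \<in> K n \<Longrightarrow> t n k \<le> 0"
    and bound: "\<And>n u. cmod (S n u) \<le> C" and lim: "\<And>u. (\<lambda>n. S n u) \<longlonglongrightarrow> 1 / lam u"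
    using causal by (rule causal_transform_approx) blast
  show ?thesis
    using G_nonpos_mult_limit[OF assms S bound lim] by simp
qed

lemma Q_in: "Q \<in> L2_pos"
  using proj by (simp add: orthogonal_projection_def)

lemma Q_sq: "square_integrable lborel Q"
  using Q_in by (auto simp: L2_fourier_supported_def is_L2_fourier_def)

lemma Q_measurable [measurable]: "Q \<in> borel_measurable borel"
  using Q_sq by (simp add: square_integrable_def)

lemma target_sq: "square_integrable lborel target"
proof (rule square_integrable_bound[OF \<gamma>_sq, where C=1])
  fix u
  have "cmod (\<gamma> u) / cmod (lam u) \<le> cmod (\<gamma> u) / 1"
    using cmod_lam_ge_1[of u] by (intro divide_left_mono) auto
  then show "cmod (target u) \<le> 1 * cmod (\<gamma> u)" by (simp add: norm_divide)
qed measurable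

lemma residual_in: "residual \<in> L2_nonpos"
proof (rule orthogonal_L2_pos_imp_L2_nonpos)
  show "square_integrable lborel residual" by (intro square_integrable_diff target_sq Q_sq)
  show "L2_inner lborel residual F = 0" if "F \<in> L2_pos" for F
    using proj that by (simp add: orthogonal_projection_def)
qed

lemma g_opt_measurable [measurable]: "g_opt \<in> borel_measurable borel"
  unfolding g_opt_def by measurable

lemma \<gamma>_lam_g_opt: "AE u in lborel. \<gamma> u * (lam u * g_opt u) = residual u"
  using \<gamma>_nonzero
proof eventually_elim
  case (elim u)
  have "\<gamma> u * (lam u * g_opt u) = \<gamma> u * (1 / cnj (lam u) - lam u * (Q u / (lam u * \<gamma> u)))"
    by (simp only: g_opt_def right_diff_distrib lam_div_normsq)
  also have "\<dots> = residual u"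
    using elim lam_nonzero[of u] by (simp add: right_diff_distrib)
  finally show ?case .
qed

text \<open>
  By \<open>\<gamma>_lam_g_opt\<close>, \<open>lam g_opt\<close> is \<open>R / \<gamma>\<close> with \<open>R\<close> the component of the target in \<^term>\<open>L2_nonpos\<close>.
\<close>

lemma g_opt_in_G_nonpos: "g_opt \<in> G_nonpos \<mu>"
proof -
  have "(\<lambda>u. lam u * g_opt u) \<in> G_nonpos \<mu>"
    by (rule in_G_nonposI[OF _ residual_in \<gamma>_lam_g_opt]) measurable
  from G_nonpos_divide_lam[OF this] show ?thesis by (simp add: lam_nonzero)
qed

lemma adaptivity_defect_eq:
  assumes [measurable]: "g \<in> borel_measurable borel"
  shows "adaptivity_defect \<mu> l g = L2_normsq lborel (\<lambda>u. \<gamma> u * (lam u * g u) - target u)"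
proof -
  have "adaptivity_defect \<mu> l g = (\<integral>\<^sup>+u. ennreal ((cmod (g u - of_real (1 / (cmod (lam u))\<^sup>2)))\<^sup>2 * (cmod (lam u))\<^sup>2) \<partial>\<mu>)"
    unfolding adaptivity_defect_def lam ..
  also have "\<dots> = (\<integral>\<^sup>+u. ennreal ((cmod (\<gamma> u))\<^sup>2) *
      ennreal ((cmod (g u - of_real (1 / (cmod (lam u))\<^sup>2)))\<^sup>2 * (cmod (lam u))\<^sup>2) \<partial>lborel)"
    by (rule nn_integral_\<mu>) measurable
  also have "\<dots> = L2_normsq lborel (\<lambda>u. \<gamma> u * (lam u * g u) - target u)"
    unfolding L2_normsq_def
  proof (rule nn_integral_cong)
    fix u
    have "\<gamma> u * (lam u * g u) - target u = \<gamma> u * (lam u * (g u - of_real (1 / (cmod (lam u))\<^sup>2)))"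
      by (simp only: right_diff_distrib lam_div_normsq) simp
    then show "ennreal ((cmod (\<gamma> u))\<^sup>2) * ennreal ((cmod (g u - of_real (1 / (cmod (lam u))\<^sup>2)))\<^sup>2 * (cmod (lam u))\<^sup>2)
      = ennreal ((cmod (\<gamma> u * (lam u * g u) - target u))\<^sup>2)"
      by (simp add: norm_mult power_mult_distrib ennreal_mult mult_ac)
  qed
  finally show ?thesis .
qed

lemma adaptivity_defect_g_opt: "adaptivity_defect \<mu> l g_opt = L2_normsq lborel Q"
proof -
  have "L2_normsq lborel (\<lambda>u. \<gamma> u * (lam u * g_opt u) - target u) = L2_normsq lborel (\<lambda>u. - Q u)"
    using \<gamma>_lam_g_opt by (intro L2_normsq_cong_AE) (auto elim: eventually_mono)
  then show ?thesis by (simp add: adaptivity_defect_eq) (simp add: L2_normsq_def)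
qed

text \<open>
  If the defect is finite, then \<open>lam g\<close> is square-integrable and therefore in \<^term>\<open>G_nonpos \<mu>\<close>; the
  deviation of \<open>\<gamma> lam g\<close> from the target then splits into an element of \<^term>\<open>L2_nonpos\<close> and \<open>Q\<close>.
\<close>

lemma adaptivity_defect_ge:
  assumes g: "g \<in> G_nonpos \<mu>"
  shows "L2_normsq lborel Q \<le> adaptivity_defect \<mu> l g"
proof (cases "adaptivity_defect \<mu> l g = \<infinity>")
  case False
  have [measurable]: "g \<in> borel_measurable borel"
    using g by (auto simp: G_nonpos_def closed_span_def square_integrable_def borel_measurable_M)
  have "square_integrable lborel (\<lambda>u. \<gamma> u * (lam u * g u) - target u)"
    using False by (simp add: square_integrable_iff_normsq_finite adaptivity_defect_eq less_top)
  from square_integrable_add[OF this target_sq]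
  have "square_integrable lborel (\<lambda>u. \<gamma> u * (lam u * g u))" by simp
  then have "square_integrable \<mu> (\<lambda>u. lam u * g u)" by (simp add: square_integrable_\<mu>_iff)
  then have "(\<lambda>u. lam u * g u) \<in> G_nonpos \<mu>"
    using preserves g by (simp add: multiplier_preserves_G_nonpos_def)
  then have w: "(\<lambda>u. \<gamma> u * (lam u * g u) - residual u) \<in> L2_nonpos" (is "?w \<in> _")
    by (intro L2_nonpos_diff \<gamma>_mult_in_L2_nonpos residual_in)
  have "L2_inner lborel ?w Q = cnj (L2_inner lborel Q ?w)" by (simp add: cnj_L2_inner)
  also have "\<dots> = 0" using L2_pos_orthogonal_L2_nonpos[OF Q_in w] by simp
  finally have orth: "L2_inner lborel ?w Q = 0" .
  have "square_integrable lborel ?w" using w unfolding L2_nonpos_eq by (rule closed_span_sq)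
  from L2_pythagoras[OF this Q_sq orth] show ?thesis by (simp add: adaptivity_defect_eq)
qed simp

lemma ERR_adaptive_plus_eq: "ERR_adaptive_plus \<mu> l = L2_normsq lborel Q"
  unfolding ERR_adaptive_plus_def
proof (rule antisym)
  show "(INF g\<in>G_nonpos \<mu>. adaptivity_defect \<mu> l g) \<le> L2_normsq lborel Q"
    using g_opt_in_G_nonpos by (rule INF_lower2) (simp add: adaptivity_defect_g_opt)
qed (rule INF_greatest, rule adaptivity_defect_ge)

text \<open>
  Completing the square at \<open>1 / |lam|\<^sup>2\<close>. The remaining term is the minimum of the
  objective over all square-integrable functions.
\<close>

lemma energy_objective_eq:
  assumes [measurable]: "g \<in> borel_measurable borel"
  shows "energy_objective \<mu> l g = adaptivity_defect \<mu> l g + (\<integral>\<^sup>+u. ennreal (1 - 1 / (cmod (lam u))\<^sup>2) \<partial>\<mu>)"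
proof -
  have "energy_objective \<mu> l g = (\<integral>\<^sup>+u. ennreal ((cmod (g u - of_real (1 / (cmod (lam u))\<^sup>2)))\<^sup>2 * (cmod (lam u))\<^sup>2)
      + ennreal (1 - 1 / (cmod (lam u))\<^sup>2) \<partial>\<mu>)"
    unfolding energy_objective_def
  proof (rule nn_integral_cong)
    fix u
    let ?L = "(cmod (lam u))\<^sup>2" and ?g = "g u"
    have L: "1 \<le> ?L" using cmod_lam_ge_1[of u] by (simp add: one_le_power)
    have "(cmod (?g - of_real (1 / ?L)))\<^sup>2 * ?L = ((Re ?g - 1 / ?L)\<^sup>2 + (Im ?g)\<^sup>2) * ?L"
      by (simp add: cmod_power2)
    also have "\<dots> = (Re ?g)\<^sup>2 * ?L - 2 * Re ?g + 1 / ?L + (Im ?g)\<^sup>2 * ?L"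
      using L lam_nonzero[of u] by (simp add: power2_diff power_divide field_simps power2_eq_square)
    finally have "(cmod (?g - 1))\<^sup>2 + (cmod ?g)\<^sup>2 * (cmod (l (\<i> * of_real u)))\<^sup>2
        = (cmod (?g - of_real (1 / ?L)))\<^sup>2 * ?L + (1 - 1 / ?L)"
      unfolding energy_eq by (simp add: cmod_power2 power2_diff algebra_simps)
    moreover have "1 / ?L \<le> 1" using L by (simp add: divide_le_eq)
    ultimately show "ennreal ((cmod (?g - 1))\<^sup>2 + (cmod ?g)\<^sup>2 * (cmod (l (\<i> * of_real u)))\<^sup>2)
        = ennreal ((cmod (?g - of_real (1 / ?L)))\<^sup>2 * ?L) + ennreal (1 - 1 / ?L)"
      by (subst ennreal_plus[symmetric]) auto
  qed
  also have "\<dots> = (\<integral>\<^sup>+u. ennreal ((cmod (g u - of_real (1 / (cmod (lam u))\<^sup>2)))\<^sup>2 * (cmod (lam u))\<^sup>2) \<partial>\<mu>)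
      + (\<integral>\<^sup>+u. ennreal (1 - 1 / (cmod (lam u))\<^sup>2) \<partial>\<mu>)"
    by (rule nn_integral_add) (simp_all add: M_is_borel measurable_cong_sets[OF M_is_borel refl])
  finally show ?thesis unfolding adaptivity_defect_def lam .
qed

lemma energy_objective_minimal:
  assumes "h \<in> G_nonpos \<mu>"
  shows "energy_objective \<mu> l g_opt \<le> energy_objective \<mu> l h"
proof -
  have "h \<in> borel_measurable borel"
    using assms by (auto simp: G_nonpos_def closed_span_def square_integrable_def borel_measurable_M)
  then show ?thesis
    using adaptivity_defect_ge[OF assms]
    by (simp add: energy_objective_eq adaptivity_defect_g_opt add_right_mono)
qed

end

theorem theorem3p3:
  fixes P :: "'w measure"
    and B :: "real \<Rightarrow> 'w \<Rightarrow> complex"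
    and K :: "real \<Rightarrow> complex"
    and W :: "real set \<Rightarrow> 'w \<Rightarrow> complex"
    and \<mu> :: "real measure"
    and f :: "real \<Rightarrow> real"
    and l :: "complex \<Rightarrow> complex"
    and \<gamma> lam Q :: "real \<Rightarrow> complex"
  assumes "prob_space P"
    and "centered_stationary P B K"
    and "is_spectral_measure K \<mu>"
    and "uncorrelated_random_measure P \<mu> W"
    and "\<And>t. has_random_measure_integral P \<mu> W (\<lambda>u. iexp (t * u)) (B t)"
    and "f \<in> borel_measurable borel" and "\<And>u. 0 \<le> f u"
    and "\<mu> = density lborel (\<lambda>u. ennreal (f u))"
    and "log_integrable f"
    and "energy_function l"
    and "outer_lower_half_plane \<gamma>"
    and "AE u in lborel. f u = (cmod (\<gamma> u))\<^sup>2"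
    and "\<And>u. (cmod (l (\<i> * of_real u)))\<^sup>2 + 1 = (cmod (lam u))\<^sup>2"
    and "inverse_is_causal_transform lam"
    and "multiplier_preserves_G_nonpos \<mu> lam"
    and "orthogonal_projection lborel L2_pos (\<lambda>u. \<gamma> u / cnj (lam u)) Q"
  shows "(let g = (\<lambda>u. of_real (1 / (cmod (lam u))\<^sup>2) - Q u / (lam u * \<gamma> u)) in
      g \<in> G_nonpos \<mu> \<and>
      (\<forall>h\<in>G_nonpos \<mu>. energy_objective \<mu> l g \<le> energy_objective \<mu> l h) \<and>
      (\<exists>X. \<forall>t. has_random_measure_integral P \<mu> W (\<lambda>u. g u * iexp (t * u)) (X t) \<and>
               X t \<in> closed_span P {B \<tau> | \<tau>. \<tau> \<le> t})) \<and>
    (\<exists>g\<in>G_nonpos \<mu>. adaptivity_defect \<mu> l g = ERR_adaptive_plus \<mu> l) \<and>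
    ERR_adaptive_plus \<mu> l = L2_normsq lborel Q"
proof -
  have fin: "finite_borel_measure \<mu>" using assms(3) by (simp add: is_spectral_measure_def)
  have pos: "AE u in lborel. 0 < f u" using assms(9) by (simp add: log_integrable_def)
  interpret adaptive_problem \<mu> f \<gamma> l lam Q
    by (intro adaptive_problem.intro outer_spectral_factor.intro adaptive_problem_axioms.intro)
      (fact assms fin pos)+
  have "\<exists>X. \<forall>t. has_random_measure_integral P \<mu> W (\<lambda>u. g_opt u * iexp (t * u)) (X t) \<and>
      X t \<in> closed_span P {B \<tau> | \<tau>. \<tau> \<le> t}"
    using adaptive_process_exists[OF assms(2-5) g_opt_in_G_nonpos] by (intro choice allI)
  then show ?thesis
    unfolding Let_def g_opt_def[symmetric]
    by (intro conjI ballI bexI[of _ g_opt] g_opt_in_G_nonpos energy_objective_minimal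
        ERR_adaptive_plus_eq adaptivity_defect_g_opt[folded ERR_adaptive_plus_eq])
qed

end
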